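(* Let $l\ge 4$ be an integer and let $x_1,x_2,x_3$ be indeterminates. Then the following two identities hold in the field of rational functions $\mathbb{R}(x_1,x_2,x_3)$. (i) \[ \begin{aligned} &T_l(x_1+x_3,x_2+x_3,x_3)+T_l(x_1+x_3,x_3+x_2,x_2)+T_l(x_3+x_1,x_1,x_2)+\frac{D_l(x_3,x_2)}{x_3}\\ &=T_l(x_1,x_2,x_3)+T_l(x_1,x_3,x_2)+T_l(x_3,x_1,x_2)+T_l(x_3,x_2+x_3,x_3)+T_l(x_3,x_3+x_2,x_2)\\ &\quad+\frac{D_l(x_1,x_2)}{x_1-x_3}+\frac{D_l(x_3,x_2)}{x_3-x_1}+\frac{D_l(x_1,x_2)}{x_2-x_3}+\frac{D_l(x_1,x_3)}{x_3-x_2}. \end{aligned} \] (ii) \[ \begin{aligned} &\sum_{\sigma\in S_3} T_l\big(x_1+x_2+x_3,\;x_{\sigma(2)}+x_{\sigma(3)},\;x_{\sigma(3)}\big)+\sum_{(i,j,k)\in C}\frac{D_l(x_k,x_j)}{x_k}\\ &=\sum_{\sigma\in S_3}\Big[T_l(x_{\sigma(1)},x_{\sigma(2)},x_{\sigma(3)})+\frac{D_l(x_{\sigma(1)},x_{\sigma(2)})}{x_{\sigma(1)}-x_{\sigma(3)}}+\frac{D_l(x_{\sigma(1)},x_{\sigma(2)})}{x_{\sigma(2)}-x_{\sigma(3)}}\Big]\\ &\quad+\sum_{(i,j,k)\in C}\Big[T_l(x_k,x_j+x_k,x_k)+T_l(x_k,x_k+x_j,x_j)+\frac{x_i^{l-1}}{(x_i-x_j)(x_i-x_k)}\,\zeta(l)\Big],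 \end{aligned} \] where $S_3$ is the set of all permutations of $\{1,2,3\}$ and $C=\{(1,2,3),(2,3,1),(3,1,2)\}$.
   Context: For a multi-index $(l_1,\dots,l_n)$ of positive integers with $l_1\ge2$, the multiple zeta value is $\zeta(l_1,\dots,l_n)=\sum_{m_1>m_2>\cdots>m_n>0}\frac{1}{m_1^{l_1}\cdots m_n^{l_n}}$. For an integer $l$, the generating functions of double and triple zeta values of weight $l$ are the polynomials $D_l(x,y)=\sum_{l_1\ge2,\,l_2\ge1,\,l_1+l_2=l} x^{l_1-1}y^{l_2-1}\zeta(l_1,l_2)$ and $T_l(x_1,x_2,x_3)=\sum_{l_1\ge2,\,l_2,l_3\ge1,\,l_1+l_2+l_3=l} x_1^{l_1-1}x_2^{l_2-1}x_3^{l_3-1}\zeta(l_1,l_2,l_3)$. *)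

theory Defs
  imports
    "HOL-Analysis.Analysis"
    "HOL-Computational_Algebra.Computational_Algebra"
    "HOL-Combinatorics.Permutations"
begin

definition mzv :: "nat list \<Rightarrow> real" where
  "mzv ls = (\<Sum>\<^sub>\<infinity> ms \<in> {ms :: nat list. length ms = length ls \<and> sorted_wrt (>) ms \<and> (\<forall>m \<in> set ms. m > 0)}.
      \<Prod>i<length ls. 1 / real (ms ! i) ^ (ls ! i))"

text \<open>The field of rational functions in three indeterminates over the reals, as the fraction
  field of the iterated polynomial ring; the innermost polynomial variable is the first
  indeterminate and the outermost one the third.\<close>

type_synonym ratfun3 = "real poly poly poly fract"

definition rconst :: "real \<Rightarrow> ratfun3" where
  "rconst c = to_fract [:[:[:c:]:]:]"

text \<open>Only the indices 1, 2, 3 are meaningful.\<close>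

definition indet :: "nat \<Rightarrow> ratfun3"  (\<open>\<xi>\<close>) where
  "\<xi> i = (if i = 1 then to_fract [:[:[:0, 1:]:]:]
          else if i = 2 then to_fract [:[:0, 1:]:]
          else if i = 3 then to_fract [:0, 1:]
          else 0)"

text \<open>The generating polynomials, as functions of the rational functions substituted for
  their variables.\<close>

definition D_gen :: "nat \<Rightarrow> ratfun3 \<Rightarrow> ratfun3 \<Rightarrow> ratfun3" where
  "D_gen l x y =
     (\<Sum>(l1, l2) \<in> {(l1, l2). l1 \<ge> 2 \<and> l2 \<ge> 1 \<and> l1 + l2 = l}.
        x ^ (l1 - 1) * y ^ (l2 - 1) * rconst (mzv [l1, l2]))"

definition T_gen :: "nat \<Rightarrow> ratfun3 \<Rightarrow> ratfun3 \<Rightarrow> ratfun3 \<Rightarrow> ratfun3" where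
  "T_gen l x y z =
     (\<Sum>(l1, l2, l3) \<in> {(l1, l2, l3). l1 \<ge> 2 \<and> l2 \<ge> 1 \<and> l3 \<ge> 1 \<and> l1 + l2 + l3 = l}.
        x ^ (l1 - 1) * y ^ (l2 - 1) * z ^ (l3 - 1) * rconst (mzv [l1, l2, l3]))"

definition cyc3 :: "(nat \<times> nat \<times> nat) set" where
  "cyc3 = {(1, 2, 3), (2, 3, 1), (3, 1, 2)}"

text \<open>The index sets are finite, so the sums defining the generating polynomials are not
  the default value of a sum over an infinite set.\<close>

lemma finite_D_gen_index:
  "finite {(l1 :: nat, l2 :: nat). l1 \<ge> 2 \<and> l2 \<ge> 1 \<and> l1 + l2 = l}"
  by (rule finite_subset[of _ "{..l} \<times> {..l}"]) auto

lemma finite_T_gen_index: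
  "finite {(l1 :: nat, l2 :: nat, l3 :: nat). l1 \<ge> 2 \<and> l2 \<ge> 1 \<and> l3 \<ge> 1 \<and> l1 + l2 + l3 = l}"
  by (rule finite_subset[of _ "{..l} \<times> {..l} \<times> {..l}"]) auto

end

theory Submission
  imports Defs "HOL-Real_Asymp.Real_Asymp"
begin

text \<open>
  Write \<open>Z(x)\<close>, \<open>D(x, y)\<close>, \<open>T(x, y, z)\<close> for the sums over indices at most \<open>N\<close> of
  \<open>1/(m - x t)\<close>, \<open>1/((m - x t)(n - y t))\<close>, \<open>1/((m - x t)(n - y t)(r - z t))\<close> with decreasing
  indices, as power series in \<open>t\<close>. Stuffle products of these are exact; partial fractions give
  shuffle products up to the contribution of the indices whose sum exceeds \<open>N\<close>. For
  \<open>D(a, b) Z(c)\<close> this error is, coefficientwise up to \<open>O(log(N)\<^sup>2 / N)\<close>, a constant plus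
  \<open>e (Z(b) - Z(0))\<close>, where the number \<open>e\<close> is the error of \<open>Z(0) Z(0)\<close>.
  Expanding \<open>(D(a, b) - D(0, b)) Z(c)\<close> both ways the errors cancel and (i) results. Expanding
  \<open>Z(x\<^sub>1) Z(x\<^sub>2) Z(x\<^sub>3)\<close> minus the cyclic sum of \<open>D(0, x\<^sub>j) Z(x\<^sub>k)\<close> both ways, the errors add up to
  a constant power series, which only affects weight 3, and (ii) results for weight at least 4.
\<close>

unbundle no vec_syntax

section \<open>Truncated generating functions and their products\<close>

text \<open>\<open>geo m x\<close> is the expansion of \<open>1/(m - x t)\<close>; for \<open>m = 0\<close> it is the junk value 0.\<close>

definition geo :: "nat \<Rightarrow> real \<Rightarrow> real fps" where
  "geo m x = Abs_fps (\<lambda>k. x ^ k / real m ^ (k + 1))"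

definition Zs :: "nat \<Rightarrow> real \<Rightarrow> real fps" where
  "Zs N x = (\<Sum>m=1..N. geo m x)"

definition Ds :: "nat \<Rightarrow> real \<Rightarrow> real \<Rightarrow> real fps" where
  "Ds N x y = (\<Sum>m=1..N. geo m x * Zs (m - 1) y)"

definition Ts :: "nat \<Rightarrow> real \<Rightarrow> real \<Rightarrow> real \<Rightarrow> real fps" where
  "Ts N x y z = (\<Sum>m=1..N. geo m x * Ds (m - 1) y z)"

lemma geo_nth: "geo m x $ k = x ^ k / real m ^ (k + 1)"
  by (simp add: geo_def)

lemma trunc_0 [simp]: "Zs 0 x = 0" "Ds 0 x y = 0" "Ts 0 x y z = 0"
  by (simp_all add: Zs_def Ds_def Ts_def)

lemma trunc_Suc:
  "Zs (Suc N) x = Zs N x + geo (Suc N) x"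
  "Ds (Suc N) x y = Ds N x y + geo (Suc N) x * Zs N y"
  "Ts (Suc N) x y z = Ts N x y z + geo (Suc N) x * Ds N y z"
  by (simp_all add: Zs_def Ds_def Ts_def)

section \<open>Partial fractions for single factors\<close>

lemma geo_inverse:
  assumes "m > 0"
  shows "(fps_const (real m) - fps_const x * fps_X) * geo m x = 1"
proof (rule fps_ext)
  fix k show "((fps_const (real m) - fps_const x * fps_X) * geo m x) $ k = 1 $ k"
    using assms by (cases k) (simp_all add: geo_nth ring_distribs mult.assoc field_simps)
qed

text \<open>For equal indices the two denominators differ by \<open>(x - y) t\<close>. Power series
  cannot be divided by \<open>t\<close>, so a factor \<open>fps_X\<close> is carried along until
  coefficients are compared.\<close>

lemma geo_stuffle:
  assumes "m > 0"
  shows "fps_X * fps_const (x - y) * (geo m x * geo m y) = geo m x - geo m y"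
proof -
  let ?A = "fps_const (real m) - fps_const x * fps_X"
  let ?B = "fps_const (real m) - fps_const y * fps_X"
  have A: "?A * geo m x = 1" and B: "?B * geo m y = 1"
    using assms by (simp_all add: geo_inverse)
  have "fps_X * fps_const (x - y) = ?B - ?A"
    by (simp add: right_diff_distrib mult_ac flip: fps_const_sub)
  hence "fps_X * fps_const (x - y) * (geo m x * geo m y) = (?B - ?A) * (geo m x * geo m y)"
    by (simp only:)
  also have "\<dots> = geo m x * (?B * geo m y) - geo m y * (?A * geo m x)"
  proof -
    have "(B - A) * (g * h) = g * (B * h) - h * (A * g)" for A B g h :: "real fps"
      by (simp add: algebra_simps)
    thus ?thesis .
  qed
  finally have "fps_X * fps_const (x - y) * (geo m x * geo m y) =
      geo m x * (?B * geo m y) - geo m y * (?A * geo m x)" .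
  thus ?thesis by (simp add: A B)
qed

lemma geo_stuffle':
  assumes "m > 0" "x \<noteq> y"
  shows "fps_X * (geo m x * geo m y) = fps_const (1 / (x - y)) * (geo m x - geo m y)"
proof -
  have "fps_const (1 / (x - y)) * (geo m x - geo m y) =
      (fps_const (1 / (x - y)) * fps_const (x - y)) * (fps_X * (geo m x * geo m y))"
    by (simp only: geo_stuffle[OF assms(1), symmetric] mult_ac)
  also have "fps_const (1 / (x - y)) * fps_const (x - y) = 1"
    using assms by simp
  finally show ?thesis by simp
qed

text \<open>Partial fractions \<open>1/(A B) = (1/A + 1/B)/(A + B)\<close>: the denominators
  \<open>m - x t\<close> and \<open>n - y t\<close> add up to the one for \<open>m + n\<close> and
  \<open>x + y\<close>.\<close>

lemma geo_shuffle:
  assumes "m > 0" "n > 0"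
  shows "geo m x * geo n y = geo (m + n) (x + y) * (geo m x + geo n y)"
proof -
  let ?A = "fps_const (real m) - fps_const x * fps_X"
  let ?B = "fps_const (real n) - fps_const y * fps_X"
  let ?C = "fps_const (real (m + n)) - fps_const (x + y) * fps_X"
  have A: "?A * geo m x = 1" and B: "?B * geo n y = 1" and C: "?C * geo (m + n) (x + y) = 1"
    using assms by (simp_all only: geo_inverse add_pos_pos)
  have C': "?C = ?A + ?B"
    by (simp add: algebra_simps flip: fps_const_add)
  have "geo m x + geo n y = (?B * geo n y) * geo m x + (?A * geo m x) * geo n y"
    by (simp only: A B mult_1_left)
  also have "\<dots> = ?C * (geo m x * geo n y)"
  proof -
    have "(B * h) * g + (A * g) * h = (A + B) * (g * h)" for A B g h :: "real fps"
      by (simp add: algebra_simps)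
    thus ?thesis unfolding C' .
  qed
  finally have "geo (m + n) (x + y) * (geo m x + geo n y) =
      (?C * geo (m + n) (x + y)) * (geo m x * geo n y)"
    by (simp only: mult_ac)
  thus ?thesis by (simp only: C mult_1_left)
qed

section \<open>Stuffle products\<close>

lemma stuffle_depth2:
  assumes "a \<noteq> b"
  shows "fps_X * (Zs N a * Zs N b) =
    fps_X * (Ds N a b + Ds N b a) + fps_const (1 / (a - b)) * (Zs N a - Zs N b)"
proof (induction N)
  case (Suc N)
  have "fps_X * (Zs (Suc N) a * Zs (Suc N) b) = fps_X * (Zs N a * Zs N b)
      + fps_X * (geo (Suc N) a * Zs N b + geo (Suc N) b * Zs N a)
      + fps_X * (geo (Suc N) a * geo (Suc N) b)"
    by (simp add: trunc_Suc algebra_simps)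
  thus ?case
    unfolding Suc.IH geo_stuffle'[OF zero_less_Suc assms] by (simp add: trunc_Suc algebra_simps)
qed simp

text \<open>The index of \<open>Zs N c\<close> lies below, between or above the two indices of
  \<open>Ds N a b\<close>, or coincides with one of them; \<open>geo_stuffle'\<close> turns the
  coincidences into sums of depth 2.\<close>

lemma stuffle_depth3:
  assumes "a \<noteq> c" "b \<noteq> c"
  shows "fps_X * (Ds N a b * Zs N c) =
    fps_X * (Ts N a b c + Ts N a c b + Ts N c a b)
    + fps_const (1 / (a - c)) * (Ds N a b - Ds N c b)
    + fps_const (1 / (b - c)) * (Ds N a b - Ds N a c)"
proof (induction N)
  case (Suc N)
  have "fps_X * (Ds (Suc N) a b * Zs (Suc N) c) = fps_X * (Ds N a b * Zs N c)
      + fps_X * geo (Suc N) c * Ds N a b + geo (Suc N) a * (fps_X * (Zs N b * Zs N c))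
      + fps_X * (geo (Suc N) a * geo (Suc N) c) * Zs N b"
    by (simp add: trunc_Suc algebra_simps)
  thus ?case
    unfolding Suc.IH geo_stuffle'[OF zero_less_Suc assms(1)] stuffle_depth2[OF assms(2)]
    by (simp add: trunc_Suc algebra_simps)
qed simp

section \<open>Shuffle products and their truncation errors\<close>

lemma conv_Suc:
  fixes u :: "nat \<Rightarrow> real fps"
  shows "(\<Sum>m=1..Suc N. u m * Zs (Suc N - m) c) =
     (\<Sum>m=1..N. u m * Zs (N - m) c) + (\<Sum>m=1..N. u m * geo (Suc N - m) c)"
proof -
  \<comment> \<open>The sums run over \<open>m + n \<le> N\<close>, so raising \<open>N\<close> adds
    the pairs with \<open>m + n = Suc N\<close>; the term \<open>m = Suc N\<close> vanishes because
    \<open>Zs 0 c = 0\<close>.\<close>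
  have "(\<Sum>m=1..N. u m * Zs (Suc N - m) c) = (\<Sum>m=1..N. u m * Zs (N - m) c + u m * geo (Suc N - m) c)"
    by (intro sum.cong) (auto simp: Suc_diff_le trunc_Suc algebra_simps)
  thus ?thesis by (simp add: sum.distrib)
qed

lemma sum_reflect:
  fixes f :: "nat \<Rightarrow> 'a::comm_monoid_add"
  shows "(\<Sum>m=1..N. f (Suc N - m)) = (\<Sum>m=1..N. f m)"
  by (rule sum.reindex_bij_witness[of _ "\<lambda>m. Suc N - m" "\<lambda>m. Suc N - m"]) auto

text \<open>On the line \<open>m + n = Suc N\<close>, \<open>geo_shuffle\<close> yields the common
  factor \<open>geo (Suc N) (a + b)\<close>, and the rest sums freely over \<open>m\<close> and over
  \<open>n\<close>.\<close>

lemma shuffle_depth2_aux: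
  "(\<Sum>m=1..N. geo m a * Zs (N - m) b) = Ds N (a + b) b + Ds N (a + b) a"
proof (induction N)
  case (Suc N)
  have "(\<Sum>m=1..N. geo m a * geo (Suc N - m) b) =
      (\<Sum>m=1..N. geo (Suc N) (a + b) * (geo m a + geo (Suc N - m) b))"
    by (intro sum.cong) (auto simp: geo_shuffle)
  also have "\<dots> = geo (Suc N) (a + b) * (Zs N a + Zs N b)"
    using sum_reflect[of "\<lambda>m. geo m b"]
    by (simp add: Zs_def sum.distrib flip: sum_distrib_left)
  finally show ?case unfolding conv_Suc Suc.IH by (simp add: trunc_Suc algebra_simps)
qed simp

lemma shuffle_depth3_aux:
  "(\<Sum>m=1..N. geo m a * Zs (m - 1) b * Zs (N - m) c) =
    Ts N (a + c) (b + c) c + Ts N (a + c) (b + c) b + Ts N (a + c) a b"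
proof (induction N)
  case (Suc N)
  have "(\<Sum>m=1..N. geo m a * Zs (m - 1) b * geo (Suc N - m) c) =
      (\<Sum>m=1..N. geo (Suc N) (a + c) * (geo m a * Zs (m - 1) b + geo (Suc N - m) c * Zs (m - 1) b))"
  proof (intro sum.cong refl)
    fix m assume "m \<in> {1..N}"
    hence "geo m a * geo (Suc N - m) c = geo (Suc N) (a + c) * (geo m a + geo (Suc N - m) c)"
      by (auto simp: geo_shuffle)
    hence "(geo m a * geo (Suc N - m) c) * Zs (m - 1) b =
        geo (Suc N) (a + c) * (geo m a + geo (Suc N - m) c) * Zs (m - 1) b"
      by simp
    thus "geo m a * Zs (m - 1) b * geo (Suc N - m) c =
        geo (Suc N) (a + c) * (geo m a * Zs (m - 1) b + geo (Suc N - m) c * Zs (m - 1) b)"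
      by (simp add: algebra_simps)
  qed
  also have "\<dots> = geo (Suc N) (a + c) *
      (Ds N a b + (\<Sum>m=1..N. geo (Suc N - m) c * Zs (m - 1) b))"
    by (simp add: Ds_def sum.distrib flip: sum_distrib_left)
  \<comment> \<open>In terms of \<open>n = Suc N - m\<close>, the index belonging to
    \<open>b\<close> is at most \<open>m - 1 = N - n\<close>: again a convolution of depth
    2.\<close>
  also have "(\<Sum>m=1..N. geo (Suc N - m) c * Zs (m - 1) b) = (\<Sum>m=1..N. geo m c * Zs (N - m) b)"
    by (subst sum_reflect[symmetric], intro sum.cong) auto
  finally show ?case
    unfolding conv_Suc Suc.IH shuffle_depth2_aux by (simp add: trunc_Suc algebra_simps)
qed simp

text \<open>The contribution of the pairs \<open>m, n \<le> N\<close> with \<open>m + n > N\<close>,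
  which \<open>shuffle_depth2_aux\<close> leaves out; \<open>err3\<close> plays the same role for
  \<open>shuffle_depth3_aux\<close>.\<close>

definition err2 :: "nat \<Rightarrow> real \<Rightarrow> real \<Rightarrow> real fps" where
  "err2 N a b = (\<Sum>m=1..N. geo m a * (Zs N b - Zs (N - m) b))"

definition err3 :: "nat \<Rightarrow> real \<Rightarrow> real \<Rightarrow> real \<Rightarrow> real fps" where
  "err3 N a b c = (\<Sum>m=1..N. geo m a * Zs (m - 1) b * (Zs N c - Zs (N - m) c))"

lemma shuffle_depth2:
  "Zs N a * Zs N b = Ds N (a + b) b + Ds N (a + b) a + err2 N a b"
  unfolding shuffle_depth2_aux[symmetric] err2_def
  by (simp add: Zs_def[of N a] sum_distrib_left sum_distrib_right algebra_simps flip: sum.distrib)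

lemma shuffle_depth3:
  "Ds N a b * Zs N c =
    Ts N (a + c) (b + c) c + Ts N (a + c) (b + c) b + Ts N (a + c) a b + err3 N a b c"
  unfolding shuffle_depth3_aux[symmetric] err3_def
  by (simp add: Ds_def sum_distrib_left sum_distrib_right algebra_simps flip: sum.distrib)

section \<open>Estimates for the shuffle errors\<close>

text \<open>The bound is split into a number \<open>s\<close>, which will carry the dependence on
  \<open>N\<close>, and a fixed series \<open>M\<close>. If \<open>s\<close> tends to 0, so does
  every coefficient.\<close>

definition fps_majorized :: "real fps \<Rightarrow> real \<Rightarrow> real fps \<Rightarrow> bool" where
  "fps_majorized f s M \<longleftrightarrow> (\<forall>k. \<bar>f $ k\<bar> \<le> s * M $ k)"

definition abs_geo :: "real \<Rightarrow> real fps" where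
  "abs_geo c = Abs_fps (\<lambda>k. \<bar>c\<bar> ^ k)"

lemma abs_geo_nth [simp]: "abs_geo c $ k = \<bar>c\<bar> ^ k"
  by (simp add: abs_geo_def)

lemma fps_majorized_mult:
  assumes "fps_majorized f s M" "fps_majorized f' s' M'"
  shows "fps_majorized (f * f') (s * s') (M * M')"
  unfolding fps_majorized_def
proof
  fix k
  have "\<bar>(f * f') $ k\<bar> \<le> (\<Sum>i=0..k. \<bar>f $ i * f' $ (k - i)\<bar>)"
    unfolding fps_mult_nth by (rule sum_abs)
  also have "\<dots> \<le> (\<Sum>i=0..k. (s * M $ i) * (s' * M' $ (k - i)))"
    unfolding abs_mult
  proof (intro sum_mono mult_mono)
    fix i
    show "\<bar>f $ i\<bar> \<le> s * M $ i" "\<bar>f' $ (k - i)\<bar> \<le> s' * M' $ (k - i)"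
      using assms by (simp_all add: fps_majorized_def)
    thus "0 \<le> s * M $ i" by (meson abs_ge_zero order_trans)
  qed simp
  also have "\<dots> = s * s' * (M * M') $ k"
    by (simp add: fps_mult_nth sum_distrib_left mult_ac)
  finally show "\<bar>(f * f') $ k\<bar> \<le> s * s' * (M * M') $ k" .
qed

lemma fps_majorized_add:
  assumes "fps_majorized f s M" "fps_majorized f' s' M"
  shows "fps_majorized (f + f') (s + s') M"
  unfolding fps_majorized_def
proof
  fix k
  have "\<bar>f $ k\<bar> \<le> s * M $ k" "\<bar>f' $ k\<bar> \<le> s' * M $ k"
    using assms by (simp_all add: fps_majorized_def)
  thus "\<bar>(f + f') $ k\<bar> \<le> (s + s') * M $ k" by (simp add: distrib_right)
qed

lemma fps_majorized_sum:
  assumes "\<And>i. i \<in> A \<Longrightarrow> fps_majorized (f i) (s i) M"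
  shows "fps_majorized (sum f A) (sum s A) M"
  using assms
proof (induction A rule: infinite_finite_induct)
  case (insert x F)
  thus ?case by (simp add: fps_majorized_add)
qed (simp_all add: fps_majorized_def)

lemma fps_majorized_abs_geo_weaken:
  assumes "fps_majorized f s (abs_geo c)" "s \<le> s'"
  shows "fps_majorized f s' (abs_geo c)"
  unfolding fps_majorized_def
proof
  fix k
  have "\<bar>f $ k\<bar> \<le> s * \<bar>c\<bar> ^ k" using assms by (simp add: fps_majorized_def)
  also have "\<dots> \<le> s' * \<bar>c\<bar> ^ k" using assms by (intro mult_right_mono) auto
  finally show "\<bar>f $ k\<bar> \<le> s' * abs_geo c $ k" by simp
qed

lemma fps_majorized_tendsto_0:
  assumes "\<And>N. fps_majorized (f N) (s N) M" "s \<longlonglongrightarrow> 0"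
  shows "(\<lambda>N. f N $ k) \<longlonglongrightarrow> 0"
proof (rule Lim_null_comparison)
  show "\<forall>\<^sub>F N in sequentially. norm (f N $ k) \<le> s N * M $ k"
    using assms(1) by (simp add: fps_majorized_def)
  show "(\<lambda>N. s N * M $ k) \<longlonglongrightarrow> 0"
    using tendsto_mult_right[OF assms(2)] by simp
qed

lemma geo_majorized:
  assumes "m > 0"
  shows "fps_majorized (geo m c) (1 / m) (abs_geo c)"
  unfolding fps_majorized_def
proof
  fix k
  have "real m \<le> real m ^ (k + 1)"
    using assms by (simp add: Suc_le_eq)
  thus "\<bar>geo m c $ k\<bar> \<le> 1 / real m * abs_geo c $ k"
    using assms by (auto simp: geo_nth abs_mult power_abs intro!: divide_left_mono)
qed

text \<open>The constant coefficients agree because \<open>0 ^ 0 = 1\<close>, and all others have at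
  least \<open>m ^ 2\<close> in the denominator. The factor \<open>1/m\<close> gained over
  \<open>geo_majorized\<close> is what makes replacing an argument by 0 cheap.\<close>

lemma geo_diff_majorized:
  assumes "m > 0"
  shows "fps_majorized (geo m c - geo m 0) (1 / real m ^ 2) (abs_geo c)"
  unfolding fps_majorized_def
proof
  fix k
  show "\<bar>(geo m c - geo m 0) $ k\<bar> \<le> 1 / real m ^ 2 * abs_geo c $ k"
  proof (cases k)
    case (Suc j)
    have "real m ^ 2 \<le> real m ^ (k + 1)"
      using assms Suc by (intro power_increasing) auto
    hence "\<bar>c\<bar> ^ k / real m ^ (k + 1) \<le> \<bar>c\<bar> ^ k / real m ^ 2"
      using assms by (intro divide_left_mono) auto
    thus ?thesis using Suc assms by (simp add: geo_nth abs_mult power_abs)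
  qed (simp add: geo_nth)
qed

lemma Zs_majorized: "fps_majorized (Zs n c) (harm n) (abs_geo c)"
  unfolding Zs_def harm_def
  by (intro fps_majorized_sum) (use geo_majorized[of _ c] in \<open>auto simp: field_simps\<close>)

text \<open>Each of the \<open>N - n\<close> additional terms is at most \<open>1/(n + 1)\<close>.
  With \<open>n = N - m\<close> the numerator becomes \<open>m\<close> and cancels a factor
  \<open>1/m\<close> in the error sums.\<close>

lemma Zs_diff_majorized:
  assumes "n \<le> N"
  shows "fps_majorized (Zs N c - Zs n c) ((real N - real n) / (real n + 1)) (abs_geo c)"
  using assms
proof (induction N rule: dec_induct)
  case (step N)
  have "fps_majorized (geo (Suc N) c) (1 / (real n + 1)) (abs_geo c)"
    by (rule fps_majorized_abs_geo_weaken[OF geo_majorized])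
       (use step in \<open>auto intro!: divide_left_mono\<close>)
  hence "fps_majorized (Zs N c - Zs n c + geo (Suc N) c)
      ((real N - real n) / (real n + 1) + 1 / (real n + 1)) (abs_geo c)"
    using step.IH by (intro fps_majorized_add)
  thus ?case by (simp add: trunc_Suc add_divide_distrib[symmetric] algebra_simps)
qed (simp add: fps_majorized_def)

text \<open>The terms with \<open>n < j \<le> N\<close> are of size
  \<open>1/j ^ 2 \<le> 2/j - 2/(j + 1)\<close>, and the bounds telescope. The constant 2 allows
  denominators \<open>n + 1\<close>, so that \<open>n = 0\<close> is covered.\<close>

lemma Zs_diff2_majorized:
  assumes "n \<le> N"
  shows "fps_majorized ((Zs N c - Zs N 0) - (Zs n c - Zs n 0))
           (2 / (real n + 1) - 2 / (real N + 1)) (abs_geo c)"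
  using assms
proof (induction N rule: dec_induct)
  case (step N)
  have "1 / real (Suc N) ^ 2 \<le> 2 / (real N + 1) - 2 / (real (Suc N) + 1)"
    by (simp add: divide_simps power2_eq_square) (simp add: algebra_simps)
  hence "fps_majorized (geo (Suc N) c - geo (Suc N) 0)
      (2 / (real N + 1) - 2 / (real (Suc N) + 1)) (abs_geo c)"
    using fps_majorized_abs_geo_weaken[OF geo_diff_majorized] by blast
  from fps_majorized_add[OF step.IH this] show ?case
    by (simp add: trunc_Suc algebra_simps)
qed (simp add: fps_majorized_def)

section \<open>Sums of reciprocals and harmonic numbers\<close>

lemma sum_inverse_products:
  "(\<Sum>m=1..N. 1 / (real m * (real (N - m) + 1))) = 2 * harm N / (real N + 1)"
proof -
  \<comment> \<open>Partial fractions: the factors \<open>m\<close> and \<open>N - m + 1\<close> add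
    up to \<open>N + 1\<close>.\<close>
  have "(\<Sum>m=1..N. 1 / (real m * (real (N - m) + 1))) =
      (\<Sum>m=1..N. (1 / real m + 1 / real (Suc N - m)) / (real N + 1))"
  proof (intro sum.cong refl)
    fix m assume "m \<in> {1..N}"
    then obtain p where "N = m + p" "m > 0" by (auto simp: le_iff_add)
    thus "1 / (real m * (real (N - m) + 1)) = (1 / real m + 1 / real (Suc N - m)) / (real N + 1)"
      by (simp add: divide_simps) (simp add: algebra_simps)
  qed
  also have "\<dots> = (\<Sum>m=1..N. 1 / real m + 1 / real (Suc N - m)) / (real N + 1)"
    by (rule sum_divide_distrib[symmetric])
  also have "(\<Sum>m=1..N. 1 / real m + 1 / real (Suc N - m)) = 2 * harm N"
    using sum_reflect[of "\<lambda>m. 1 / real m" N] by (simp add: sum.distrib harm_def inverse_eq_divide)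
  finally show ?thesis .
qed

text \<open>\<open>harm N\<close> is \<open>ln N\<close> plus a convergent sequence. The square root
  is there so that squaring this limit handles \<open>harm N * harm N / (N + 1)\<close>.\<close>

lemma harm_over_sqrt_tendsto_0: "(\<lambda>N. harm N / sqrt (real N + 1) :: real) \<longlonglongrightarrow> 0"
proof -
  have "(\<lambda>N. harm N - ln (real N) :: real) \<longlonglongrightarrow> euler_mascheroni"
    by (rule euler_mascheroni_LIMSEQ)
  moreover have "(\<lambda>N. 1 / sqrt (real N + 1)) \<longlonglongrightarrow> 0" by real_asymp
  ultimately have "(\<lambda>N. (harm N - ln (real N)) * (1 / sqrt (real N + 1))) \<longlonglongrightarrow> 0"
    using tendsto_mult by fastforce
  moreover have "(\<lambda>N. ln (real N) / sqrt (real N + 1)) \<longlonglongrightarrow> 0" by real_asymp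
  ultimately have "(\<lambda>N. (harm N - ln (real N)) * (1 / sqrt (real N + 1))
      + ln (real N) / sqrt (real N + 1)) \<longlonglongrightarrow> 0"
    using tendsto_add by fastforce
  thus ?thesis by (simp add: field_simps)
qed

lemma harm_square_over_tendsto_0: "(\<lambda>N. harm N * harm N / (real N + 1) :: real) \<longlonglongrightarrow> 0"
  using tendsto_mult[OF harm_over_sqrt_tendsto_0 harm_over_sqrt_tendsto_0] by simp

lemma harm_over_tendsto_0: "(\<lambda>N. harm N / (real N + 1) :: real) \<longlonglongrightarrow> 0"
proof -
  have "(\<lambda>N. 1 / sqrt (real N + 1)) \<longlonglongrightarrow> 0" by real_asymp
  from tendsto_mult[OF harm_over_sqrt_tendsto_0 this] show ?thesis by simp
qed

section \<open>Limits of the shuffle errors\<close>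

lemma err2_diff_tendsto_0:
  "(\<lambda>N. ((err2 N a b - err2 N 0 0) * Zs N c) $ k) \<longlonglongrightarrow> 0"
proof -
  \<comment> \<open>\<open>P\<close> is the change on replacing \<open>a\<close> by 0,
    \<open>Q\<close> the change on then replacing \<open>b\<close> by 0. Both are of size
    \<open>harm N / (N + 1)\<close>, and \<open>Zs N c\<close> contributes one more
    \<open>harm N\<close>.\<close>
  define P where "P N = (\<Sum>m=1..N. (geo m a - geo m 0) * (Zs N b - Zs (N - m) b))" for N
  define Q where "Q N = (\<Sum>m=1..N. geo m 0 * ((Zs N b - Zs N 0) - (Zs (N - m) b - Zs (N - m) 0)))" for N
  have eq: "(err2 N a b - err2 N 0 0) * Zs N c = P N * Zs N c + Q N * Zs N c" for N
  proof -
    have "err2 N a b - err2 N 0 0 = P N + Q N"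
      unfolding err2_def P_def Q_def sum.distrib[symmetric] sum_subtractf[symmetric]
      by (intro sum.cong) (simp_all add: algebra_simps)
    thus ?thesis by (simp add: distrib_right)
  qed
  have "fps_majorized (P N) (2 * harm N / (real N + 1)) (abs_geo a * abs_geo b)" for N
    unfolding sum_inverse_products[symmetric] P_def
  proof (intro fps_majorized_sum)
    fix m assume m: "m \<in> {1..N}"
    have "fps_majorized ((geo m a - geo m 0) * (Zs N b - Zs (N - m) b))
      (1 / real m ^ 2 * ((real N - real (N - m)) / (real (N - m) + 1))) (abs_geo a * abs_geo b)"
      using m by (intro fps_majorized_mult geo_diff_majorized Zs_diff_majorized) auto
    also have "1 / real m ^ 2 * ((real N - real (N - m)) / (real (N - m) + 1)) =
        1 / (real m * (real (N - m) + 1))"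
      using m by (simp add: of_nat_diff power2_eq_square)
    finally show "fps_majorized ((geo m a - geo m 0) * (Zs N b - Zs (N - m) b))
      (1 / (real m * (real (N - m) + 1))) (abs_geo a * abs_geo b)" .
  qed
  hence "fps_majorized (P N * Zs N c) (2 * harm N / (real N + 1) * harm N)
      (abs_geo a * abs_geo b * abs_geo c)" for N
    by (intro fps_majorized_mult Zs_majorized)
  moreover have lim: "(\<lambda>N. 2 * harm N / (real N + 1) * harm N :: real) \<longlonglongrightarrow> 0"
    using tendsto_mult_left[OF harm_square_over_tendsto_0, of 2] by (simp add: mult_ac)
  ultimately have 1: "(\<lambda>N. (P N * Zs N c) $ k) \<longlonglongrightarrow> 0"
    by (rule fps_majorized_tendsto_0)
  have "fps_majorized (Q N) (2 * harm N / (real N + 1)) (abs_geo 0 * abs_geo b)" for N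
  proof -
    have "fps_majorized (Q N) (\<Sum>m=1..N. (2 / (real N + 1)) * (1 / real (Suc N - m))) (abs_geo 0 * abs_geo b)"
      unfolding Q_def
    proof (intro fps_majorized_sum)
      fix m assume m: "m \<in> {1..N}"
      have "fps_majorized (geo m 0 * ((Zs N b - Zs N 0) - (Zs (N - m) b - Zs (N - m) 0)))
        (1 / real m * (2 / (real (N - m) + 1) - 2 / (real N + 1))) (abs_geo 0 * abs_geo b)"
        using m by (intro fps_majorized_mult geo_majorized Zs_diff2_majorized) auto
      \<comment> \<open>The difference of reciprocals is \<open>2 m / ((N - m + 1) (N + 1))\<close>,
        whose \<open>m\<close> cancels \<open>1/m\<close>.\<close>
      also have "1 / real m * (2 / (real (N - m) + 1) - 2 / (real N + 1)) =
          (2 / (real N + 1)) * (1 / real (Suc N - m))"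
        using m by (simp add: of_nat_diff field_simps)
      finally show "fps_majorized (geo m 0 * ((Zs N b - Zs N 0) - (Zs (N - m) b - Zs (N - m) 0)))
        ((2 / (real N + 1)) * (1 / real (Suc N - m))) (abs_geo 0 * abs_geo b)" .
    qed
    also have "(\<Sum>m=1..N. (2 / (real N + 1)) * (1 / real (Suc N - m))) =
        (2 / (real N + 1)) * (\<Sum>m=1..N. 1 / real (Suc N - m))"
      by (rule sum_distrib_left[symmetric])
    also have "(\<Sum>m=1..N. 1 / real (Suc N - m)) = harm N"
      using sum_reflect[of "\<lambda>m. 1 / real m" N] by (simp add: harm_def inverse_eq_divide)
    finally show ?thesis by simp
  qed
  hence "fps_majorized (Q N * Zs N c) (2 * harm N / (real N + 1) * harm N)
      (abs_geo 0 * abs_geo b * abs_geo c)" for N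
    by (intro fps_majorized_mult Zs_majorized)
  from this lim have 2: "(\<lambda>N. (Q N * Zs N c) $ k) \<longlonglongrightarrow> 0"
    by (rule fps_majorized_tendsto_0)
  show ?thesis using tendsto_add[OF 1 2] by (simp add: eq)
qed

lemma harm_majorizes_Zs:
  assumes "n \<le> N"
  shows "fps_majorized (Zs n c) (harm N) (abs_geo c)"
  using fps_majorized_abs_geo_weaken[OF Zs_majorized harm_mono[OF assms]] .

text \<open>Three replacements: \<open>a\<close> by 0 (\<open>P\<close>), \<open>c\<close> by 0
  (\<open>Q\<close>), and \<open>Zs (m - 1) b - Zs (m - 1) 0\<close> by its value at
  \<open>N\<close> (\<open>R\<close>), the missing tail being at most \<open>2/m\<close>. The last
  one makes this factor independent of \<open>m\<close>, so that \<open>err2 N 0 0\<close> splits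
  off.\<close>

lemma err3_diff_tendsto_0:
  "(\<lambda>N. (err3 N a b c - err3 N 0 0 0 - err2 N 0 0 * (Zs N b - Zs N 0)) $ k) \<longlonglongrightarrow> 0"
proof -
  define V where "V N n x = (Zs N x - Zs N 0) - (Zs n x - Zs n 0)" for N n x
  define P where "P N = (\<Sum>m=1..N. (geo m a - geo m 0) * Zs (m - 1) b * (Zs N c - Zs (N - m) c))" for N
  define Q where "Q N = (\<Sum>m=1..N. geo m 0 * Zs (m - 1) b * V N (N - m) c)" for N
  define R where "R N = (\<Sum>m=1..N. geo m 0 * (Zs N 0 - Zs (N - m) 0) * V N (m - 1) b)" for N
  have eq: "err3 N a b c - err3 N 0 0 0 - err2 N 0 0 * (Zs N b - Zs N 0) = P N + Q N - R N" for N
    unfolding err3_def err2_def P_def Q_def R_def V_def sum_distrib_right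
      sum.distrib[symmetric] sum_subtractf[symmetric]
    by (intro sum.cong) (simp_all add: algebra_simps)
  have lim: "(\<lambda>N. 2 * harm N / (real N + 1) * harm N :: real) \<longlonglongrightarrow> 0"
    using tendsto_mult_left[OF harm_square_over_tendsto_0, of 2] by (simp add: mult_ac)
  have "fps_majorized (P N) (2 * harm N / (real N + 1) * harm N) (abs_geo a * abs_geo b * abs_geo c)" for N
    unfolding sum_inverse_products[symmetric] sum_distrib_right P_def
  proof (intro fps_majorized_sum)
    fix m assume m: "m \<in> {1..N}"
    have "fps_majorized ((geo m a - geo m 0) * Zs (m - 1) b * (Zs N c - Zs (N - m) c))
      (1 / real m ^ 2 * harm N * ((real N - real (N - m)) / (real (N - m) + 1)))
      (abs_geo a * abs_geo b * abs_geo c)"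
      using m by (intro fps_majorized_mult geo_diff_majorized Zs_diff_majorized harm_majorizes_Zs) auto
    also have "1 / real m ^ 2 * harm N * ((real N - real (N - m)) / (real (N - m) + 1)) =
        1 / (real m * (real (N - m) + 1)) * harm N"
      using m by (simp add: of_nat_diff power2_eq_square)
    finally show "fps_majorized ((geo m a - geo m 0) * Zs (m - 1) b * (Zs N c - Zs (N - m) c))
      (1 / (real m * (real (N - m) + 1)) * harm N) (abs_geo a * abs_geo b * abs_geo c)" .
  qed
  from this lim have 1: "(\<lambda>N. P N $ k) \<longlonglongrightarrow> 0" by (rule fps_majorized_tendsto_0)
  have "fps_majorized (Q N) (2 * harm N / (real N + 1) * harm N) (abs_geo 0 * abs_geo b * abs_geo c)" for N
  proof -
    have "fps_majorized (Q N) (\<Sum>m=1..N. (2 / (real N + 1) * harm N) * (1 / real (Suc N - m)))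
        (abs_geo 0 * abs_geo b * abs_geo c)"
      unfolding Q_def V_def
    proof (intro fps_majorized_sum)
      fix m assume m: "m \<in> {1..N}"
      have "fps_majorized (geo m 0 * Zs (m - 1) b * ((Zs N c - Zs N 0) - (Zs (N - m) c - Zs (N - m) 0)))
        (1 / real m * harm N * (2 / (real (N - m) + 1) - 2 / (real N + 1)))
        (abs_geo 0 * abs_geo b * abs_geo c)"
        using m by (intro fps_majorized_mult geo_majorized Zs_diff2_majorized harm_majorizes_Zs) auto
      also have "1 / real m * harm N * (2 / (real (N - m) + 1) - 2 / (real N + 1)) =
          (2 / (real N + 1) * harm N) * (1 / real (Suc N - m))"
        using m by (simp add: of_nat_diff divide_simps)
      finally show "fps_majorized (geo m 0 * Zs (m - 1) b * ((Zs N c - Zs N 0) - (Zs (N - m) c - Zs (N - m) 0)))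
        ((2 / (real N + 1) * harm N) * (1 / real (Suc N - m))) (abs_geo 0 * abs_geo b * abs_geo c)" .
    qed
    also have "(\<Sum>m=1..N. (2 / (real N + 1) * harm N) * (1 / real (Suc N - m))) =
        (2 / (real N + 1) * harm N) * (\<Sum>m=1..N. 1 / real (Suc N - m))"
      by (rule sum_distrib_left[symmetric])
    also have "(\<Sum>m=1..N. 1 / real (Suc N - m)) = harm N"
      using sum_reflect[of "\<lambda>m. 1 / real m" N] by (simp add: harm_def inverse_eq_divide)
    finally show ?thesis by simp
  qed
  from this lim have 2: "(\<lambda>N. Q N $ k) \<longlonglongrightarrow> 0" by (rule fps_majorized_tendsto_0)
  have "fps_majorized (R N) (2 * harm N / (real N + 1) * 2) (abs_geo 0 * abs_geo 0 * abs_geo b)" for N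
    unfolding sum_inverse_products[symmetric] sum_distrib_right R_def V_def
  proof (intro fps_majorized_sum)
    fix m assume m: "m \<in> {1..N}"
    have V: "fps_majorized ((Zs N b - Zs N 0) - (Zs (m - 1) b - Zs (m - 1) 0)) (2 / real m) (abs_geo b)"
      by (rule fps_majorized_abs_geo_weaken[OF Zs_diff2_majorized]) (use m in auto)
    have "fps_majorized (geo m 0 * (Zs N 0 - Zs (N - m) 0) * ((Zs N b - Zs N 0) - (Zs (m - 1) b - Zs (m - 1) 0)))
      (1 / real m * ((real N - real (N - m)) / (real (N - m) + 1)) * (2 / real m))
      (abs_geo 0 * abs_geo 0 * abs_geo b)"
      using m by (intro fps_majorized_mult geo_majorized Zs_diff_majorized V) auto
    also have "1 / real m * ((real N - real (N - m)) / (real (N - m) + 1)) * (2 / real m) =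
        1 / (real m * (real (N - m) + 1)) * 2"
      using m by (simp add: of_nat_diff)
    finally show "fps_majorized (geo m 0 * (Zs N 0 - Zs (N - m) 0) * ((Zs N b - Zs N 0) - (Zs (m - 1) b - Zs (m - 1) 0)))
      (1 / (real m * (real (N - m) + 1)) * 2) (abs_geo 0 * abs_geo 0 * abs_geo b)" .
  qed
  moreover have "(\<lambda>N. 2 * harm N / (real N + 1) * 2 :: real) \<longlonglongrightarrow> 0"
    using tendsto_mult_left[OF harm_over_tendsto_0, of 4] by (simp add: mult_ac)
  ultimately have 3: "(\<lambda>N. R N $ k) \<longlonglongrightarrow> 0" by (rule fps_majorized_tendsto_0)
  show ?thesis using tendsto_diff[OF tendsto_add[OF 1 2] 3] by (simp add: eq)
qed

lemma geo_at_0: "geo m 0 = fps_const (1 / real m)"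
  by (rule fps_ext) (simp add: geo_nth)

lemma fps_const_sum: "(\<Sum>i\<in>A. fps_const (f i)) = fps_const (\<Sum>i\<in>A. f i)"
  by (induction A rule: infinite_finite_induct) simp_all

lemma Zs_at_0: "Zs n 0 = fps_const (harm n)"
  unfolding Zs_def geo_at_0 fps_const_sum by (simp add: harm_def inverse_eq_divide)

text \<open>At arguments 0 all factors are constant series. This is where weight 3, which belongs to
  \<open>k = 0\<close>, is separated from the higher weights.\<close>

lemma err_at_0_nth:
  assumes "k > 0"
  shows "err3 N 0 0 0 $ k = 0" "(err2 N 0 0 * Zs N 0) $ k = 0"
  unfolding err3_def err2_def geo_at_0 Zs_at_0 fps_const_mult fps_const_sub fps_const_sum
  using assms by simp_all

section \<open>Truncated multiple zeta values\<close>

text \<open>The recursion peels off the largest index, as \<open>Zs\<close>, \<open>Ds\<close> and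
  \<open>Ts\<close> do, so that their coefficients can be read off.\<close>

fun mzv_upto :: "nat \<Rightarrow> nat list \<Rightarrow> real" where
  "mzv_upto N [] = 1"
| "mzv_upto N (l # ls) = (\<Sum>m=1..N. 1 / real m ^ l * mzv_upto (m - 1) ls)"

definition mzv_index :: "nat \<Rightarrow> nat list set" where
  "mzv_index n = {ms. length ms = n \<and> sorted_wrt (>) ms \<and> (\<forall>m \<in> set ms. m > 0)}"

definition mzv_index_upto :: "nat \<Rightarrow> nat \<Rightarrow> nat list set" where
  "mzv_index_upto N n = {ms \<in> mzv_index n. \<forall>m \<in> set ms. m \<le> N}"

lemma mzv_index_upto_Suc:
  "mzv_index_upto N (Suc n) = (\<lambda>(m, ms). m # ms) ` (SIGMA m:{1..N}. mzv_index_upto (m - 1) n)"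
proof -
  have "ms \<in> mzv_index_upto N (Suc n) \<longleftrightarrow>
     (\<exists>m ms'. ms = m # ms' \<and> m \<in> {1..N} \<and> ms' \<in> mzv_index_upto (m - 1) n)" for ms
    by (cases ms) (fastforce simp: mzv_index_upto_def mzv_index_def)+
  thus ?thesis by (auto simp: image_iff)
qed

lemma finite_mzv_index_upto: "finite (mzv_index_upto N n)"
proof (induction n arbitrary: N)
  case 0
  have "mzv_index_upto N 0 \<subseteq> {[]}" by (auto simp: mzv_index_upto_def mzv_index_def)
  thus ?case by (rule finite_subset) simp
qed (simp add: mzv_index_upto_Suc)

lemma mzv_upto_eq_sum:
  "mzv_upto N ls = (\<Sum>ms \<in> mzv_index_upto N (length ls). \<Prod>i<length ls. 1 / real (ms ! i) ^ (ls ! i))"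
proof (induction ls arbitrary: N)
  case Nil
  have "mzv_index_upto N 0 = {[]}" by (auto simp: mzv_index_upto_def mzv_index_def)
  thus ?case by simp
next
  case (Cons l ls)
  have inj: "inj_on (\<lambda>(m, ms). m # ms) (SIGMA m:{1..N}. mzv_index_upto (m - 1) (length ls))"
    by (auto simp: inj_on_def)
  show ?case
    unfolding length_Cons mzv_index_upto_Suc sum.reindex[OF inj] mzv_upto.simps Cons
      sum_distrib_left prod.lessThan_Suc_shift
    by (simp add: sum.Sigma finite_mzv_index_upto case_prod_unfold)
qed

lemma mzv_upto_nonneg: "mzv_upto N ls \<ge> 0"
  by (simp add: mzv_upto_eq_sum sum_nonneg prod_nonneg)

text \<open>The second summand on the left only serves to make the induction work. The lemma lets one
  absorb the second of two nested summations into the exponent of the first.\<close>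

lemma sum_inverse_square_partial_sums_le:
  fixes a :: "nat \<Rightarrow> real"
  assumes "\<And>m. a m \<ge> 0"
  shows "(\<Sum>m=1..N. 1 / real m ^ 2 * (\<Sum>j=1..m-1. a j)) + (\<Sum>j=1..N. a j) / real N
    \<le> (\<Sum>m=1..N. a m / real m)"
proof (induction N)
  case (Suc N)
  define A where "A = (\<Sum>j=1..N. a j)"
  have "A \<ge> 0" unfolding A_def using assms by (simp add: sum_nonneg)
  have le: "A / real (Suc N) ^ 2 + A / real (Suc N) \<le> A / real N"
  proof (cases "N = 0")
    case False
    have "1 / real (Suc N) ^ 2 + 1 / real (Suc N) \<le> 1 / real N"
      using False by (simp add: divide_simps power2_eq_square) (simp add: algebra_simps)
    from mult_left_mono[OF this \<open>A \<ge> 0\<close>] show ?thesis by (simp add: distrib_left)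
  qed (simp add: A_def)
  show ?case using Suc.IH le unfolding A_def by (simp add: add_divide_distrib)
qed simp

lemma mzv_upto_le_2: "mzv_upto N (2 # replicate r 1) \<le> 2"
proof (induction r)
  case 0
  have "(\<Sum>m=1..N. 1 / real m ^ 2) \<le> 2 - 1 / real N" for N
  proof (induction N)
    case (Suc N)
    \<comment> \<open>At \<open>N = 0\<close> the induction hypothesis has the bound
      \<open>2 - 1/0 = 2\<close>, too weak for telescoping, so the step to \<open>N = 1\<close> is
      separate.\<close>
    show ?case
    proof (cases "N = 0")
      case False
      have "1 / real (Suc N) ^ 2 \<le> 1 / real N - 1 / real (Suc N)"
        using False by (simp add: divide_simps power2_eq_square)
      thus ?thesis using Suc.IH by simp
    qed simp
  qed simp
  from order_trans[OF this] show ?case by simp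
next
  case (Suc r)
  define a where "a m = 1 / real m * mzv_upto (m - 1) (replicate r 1)" for m
  have a: "a m \<ge> 0" for m by (simp add: a_def mzv_upto_nonneg)
  have "mzv_upto N (2 # replicate (Suc r) 1) = (\<Sum>m=1..N. 1 / real m ^ 2 * (\<Sum>j=1..m-1. a j))"
    by (simp add: a_def)
  also have "\<dots> \<le> (\<Sum>m=1..N. a m / real m)"
    using sum_inverse_square_partial_sums_le[of a N, OF a]
      divide_nonneg_nonneg[OF sum_nonneg[of "{1..N}" a, OF a], of "real N"] by simp
  also have "\<dots> = mzv_upto N (2 # replicate r 1)"
    by (simp add: a_def power2_eq_square mult_ac)
  finally show ?case using Suc.IH by simp
qed

lemma mzv_upto_mono:
  assumes "list_all2 (\<le>) ls ls'"
  shows "mzv_upto N ls' \<le> mzv_upto N ls"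
  using assms
proof (induction arbitrary: N rule: list_all2_induct)
  case (Cons l ls l' ls')
  have "1 / real m ^ l' \<le> 1 / real m ^ l" if "m \<in> {1..N}" for m
    using that Cons.hyps by (intro divide_left_mono power_increasing) auto
  thus ?case unfolding mzv_upto.simps using Cons.IH
    by (intro sum_mono mult_mono mzv_upto_nonneg) auto
qed simp

text \<open>Admissible exponents dominate \<open>2, 1, ..., 1\<close> entrywise, so the bound 2
  gives summability. As \<open>mzv\<close> is an unordered sum, it then suffices that the truncated
  index sets eventually contain every finite set of indices.\<close>

lemma mzv_upto_tendsto:
  assumes "l \<ge> 2" "\<forall>l' \<in> set ls. l' \<ge> 1"
  shows "(\<lambda>N. mzv_upto N (l # ls)) \<longlonglongrightarrow> mzv (l # ls)"
proof -
  define f where "f ms = (\<Prod>i<length (l # ls). 1 / real (ms ! i) ^ ((l # ls) ! i))" for ms :: "nat list"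
  let ?n = "length (l # ls)"
  have upto: "mzv_upto N (l # ls) = sum f (mzv_index_upto N ?n)" for N
    unfolding mzv_upto_eq_sum f_def ..
  have bound: "sum f (mzv_index_upto N ?n) \<le> 2" for N
  proof -
    have "list_all2 (\<le>) (2 # replicate (length ls) 1) (l # ls)"
      using assms by (auto simp: list_all2_conv_all_nth nth_Cons split: nat.splits)
    from mzv_upto_mono[OF this, of N] mzv_upto_le_2[of N "length ls"] show ?thesis
      unfolding upto by linarith
  qed
  have f: "f ms \<ge> 0" for ms by (simp add: f_def prod_nonneg)
  have cover: "F \<subseteq> mzv_index_upto N ?n"
    if "finite F" "F \<subseteq> mzv_index ?n" "N \<ge> Max (insert 0 (\<Union>(set ` F)))" for F N
  proof
    fix ms assume ms: "ms \<in> F"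
    have "m \<le> N" if "m \<in> set ms" for m
    proof -
      have "m \<le> Max (insert 0 (\<Union>(set ` F)))"
        using \<open>finite F\<close> ms that by (intro Max_ge) auto
      thus ?thesis using \<open>N \<ge> _\<close> by linarith
    qed
    thus "ms \<in> mzv_index_upto N ?n" using ms that(2) by (auto simp: mzv_index_upto_def)
  qed
  have "f summable_on mzv_index ?n"
  proof (rule nonneg_bdd_above_summable_on)
    show "bdd_above (sum f ` {F. F \<subseteq> mzv_index ?n \<and> finite F})"
    proof (rule bdd_aboveI2)
      fix F assume "F \<in> {F. F \<subseteq> mzv_index ?n \<and> finite F}"
      hence "sum f F \<le> sum f (mzv_index_upto (Max (insert 0 (\<Union>(set ` F)))) ?n)"
        using f by (intro sum_mono2 finite_mzv_index_upto cover) auto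
      thus "sum f F \<le> 2" using bound order_trans by blast
    qed
  qed (rule f)
  hence "(f has_sum mzv (l # ls)) (mzv_index ?n)"
    unfolding mzv_def f_def mzv_index_def by (rule has_sum_infsum)
  hence "(sum f \<longlongrightarrow> mzv (l # ls)) (finite_subsets_at_top (mzv_index ?n))"
    by (simp add: has_sum_def)
  moreover have "filterlim (\<lambda>N. mzv_index_upto N ?n) (finite_subsets_at_top (mzv_index ?n)) sequentially"
    unfolding filterlim_finite_subsets_at_top
  proof (intro allI impI)
    fix F assume F: "finite F \<and> F \<subseteq> mzv_index ?n"
    show "\<forall>\<^sub>F N in sequentially. finite (mzv_index_upto N ?n) \<and>
        F \<subseteq> mzv_index_upto N ?n \<and> mzv_index_upto N ?n \<subseteq> mzv_index ?n"
      using eventually_ge_at_top[of "Max (insert 0 (\<Union>(set ` F)))"]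
    proof eventually_elim
      case (elim N)
      have "mzv_index_upto N ?n \<subseteq> mzv_index ?n" by (auto simp: mzv_index_upto_def)
      thus ?case using cover[of F N] F elim finite_mzv_index_upto by blast
    qed
  qed
  ultimately show ?thesis
    unfolding upto by (rule filterlim_compose)
qed

section \<open>The identities at real arguments\<close>

definition D_real :: "nat \<Rightarrow> real \<Rightarrow> real \<Rightarrow> real" where
  "D_real l x y =
     (\<Sum>(l1, l2) \<in> {(l1, l2). l1 \<ge> 2 \<and> l2 \<ge> 1 \<and> l1 + l2 = l}.
        x ^ (l1 - 1) * y ^ (l2 - 1) * mzv [l1, l2])"

definition T_real :: "nat \<Rightarrow> real \<Rightarrow> real \<Rightarrow> real \<Rightarrow> real" where
  "T_real l x y z =
     (\<Sum>(l1, l2, l3) \<in> {(l1, l2, l3). l1 \<ge> 2 \<and> l2 \<ge> 1 \<and> l3 \<ge> 1 \<and> l1 + l2 + l3 = l}.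
        x ^ (l1 - 1) * y ^ (l2 - 1) * z ^ (l3 - 1) * mzv [l1, l2, l3])"

lemma D_real_altdef:
  "D_real (k + 2) x y = (\<Sum>i=1..k. x ^ i * (y ^ (k - i) * mzv [i + 1, k - i + 1]))"
  unfolding D_real_def
proof (rule sum.reindex_bij_witness[of _ "\<lambda>i. (i + 1, k - i + 1)" "\<lambda>(l1, l2). l1 - 1"])
  fix p assume "p \<in> {(l1, l2). l1 \<ge> 2 \<and> l2 \<ge> 1 \<and> l1 + l2 = k + 2}"
  then obtain i m where "p = (i + 2, m + 1)" "k = i + m + 1"
    by (cases p) (auto simp: le_iff_add add_ac)
  thus "((case p of (l1, l2) \<Rightarrow> l1 - 1) + 1, k - (case p of (l1, l2) \<Rightarrow> l1 - 1) + 1) = p"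
    "(case p of (l1, l2) \<Rightarrow> l1 - 1) \<in> {1..k}"
    "x ^ (case p of (l1, l2) \<Rightarrow> l1 - 1) * (y ^ (k - (case p of (l1, l2) \<Rightarrow> l1 - 1)) *
       mzv [(case p of (l1, l2) \<Rightarrow> l1 - 1) + 1, k - (case p of (l1, l2) \<Rightarrow> l1 - 1) + 1]) =
     (case p of (l1, l2) \<Rightarrow> x ^ (l1 - 1) * y ^ (l2 - 1) * mzv [l1, l2])"
    by (auto simp: mult_ac)
qed auto

lemma T_real_altdef:
  "T_real (k + 3) x y z = (\<Sum>i=1..k. x ^ i * (\<Sum>j=0..k-i. y ^ j * (z ^ (k - i - j) *
     mzv [i + 1, j + 1, k - i - j + 1])))"
proof -
  have "T_real (k + 3) x y z = (\<Sum>(i, j) \<in> (SIGMA i:{1..k}. {0..k-i}).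
      x ^ i * (y ^ j * (z ^ (k - i - j) * mzv [i + 1, j + 1, k - i - j + 1])))"
    unfolding T_real_def
  proof (rule sum.reindex_bij_witness[of _ "\<lambda>(i, j). (i + 1, j + 1, k - i - j + 1)"
        "\<lambda>(l1, l2, l3). (l1 - 1, l2 - 1)"])
    fix p assume "p \<in> {(l1, l2, l3). l1 \<ge> 2 \<and> l2 \<ge> 1 \<and> l3 \<ge> 1 \<and> l1 + l2 + l3 = k + 3}"
    then obtain i j m where "p = (i + 2, j + 1, m + 1)" "k = i + j + m + 1"
      by (cases p) (auto simp: le_iff_add add_ac)
    thus "(case case p of (l1, l2, l3) \<Rightarrow> (l1 - 1, l2 - 1) of (i, j) \<Rightarrow> (i + 1, j + 1, k - i - j + 1)) = p"
      "(case p of (l1, l2, l3) \<Rightarrow> (l1 - 1, l2 - 1)) \<in> (SIGMA i:{1..k}. {0..k-i})"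
      "(case case p of (l1, l2, l3) \<Rightarrow> (l1 - 1, l2 - 1) of (i, j) \<Rightarrow>
         x ^ i * (y ^ j * (z ^ (k - i - j) * mzv [i + 1, j + 1, k - i - j + 1]))) =
       (case p of (l1, l2, l3) \<Rightarrow> x ^ (l1 - 1) * y ^ (l2 - 1) * z ^ (l3 - 1) * mzv [l1, l2, l3])"
      by (auto simp: mult_ac)
  qed auto
  thus ?thesis by (simp add: sum.Sigma sum_distrib_left)
qed

lemma geo_sum_nth:
  "(\<Sum>m=1..N. geo m x * F (m - 1)) $ k =
     (\<Sum>i=0..k. x ^ i * (\<Sum>m=1..N. 1 / real m ^ (i + 1) * F (m - 1) $ (k - i)))"
  unfolding fps_sum_nth fps_mult_nth geo_nth sum_distrib_left
  by (subst sum.swap) (simp add: mult_ac)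

lemma Zs_nth: "Zs N x $ k = x ^ k * mzv_upto N [k + 1]"
  by (simp add: Zs_def fps_sum_nth geo_nth sum_distrib_left)

lemma Ds_nth: "Ds N x y $ k = (\<Sum>i=0..k. x ^ i * (y ^ (k - i) * mzv_upto N [i + 1, k - i + 1]))"
  unfolding Ds_def geo_sum_nth[of x "\<lambda>n. Zs n y"] Zs_nth
  unfolding mzv_upto.simps(2)[of N "_ + 1"] sum_distrib_left by (simp only: mult_ac)

lemma Ts_nth: "Ts N x y z $ k = (\<Sum>i=0..k. x ^ i * (\<Sum>j=0..k-i. y ^ j * (z ^ (k - i - j) *
     mzv_upto N [i + 1, j + 1, k - i - j + 1])))"
proof -
  have "(\<Sum>m=1..N. 1 / real m ^ (i + 1) * Ds (m - 1) y z $ (k - i)) =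
      (\<Sum>j=0..k-i. y ^ j * (z ^ (k - i - j) * mzv_upto N [i + 1, j + 1, k - i - j + 1]))" for i
    unfolding Ds_nth sum_distrib_left mzv_upto.simps(2)[of N "i + 1"]
    by (subst sum.swap) (simp only: mult_ac)
  thus ?thesis unfolding Ts_def geo_sum_nth[of x "\<lambda>n. Ds n y z"] by (simp only:)
qed

text \<open>Since \<open>0 ^ 0 = 1\<close>, only \<open>i = 0\<close> survives in the second sum.
  Subtracting the value at \<open>x = 0\<close> thus removes exactly the terms with leading exponent
  1, whose truncated sums diverge.\<close>

lemma power_sum_minus_at_0:
  fixes f :: "nat \<Rightarrow> real"
  shows "(\<Sum>i=0..k. x ^ i * f i) - (\<Sum>i=0..k. 0 ^ i * f i) = (\<Sum>i=1..k. x ^ i * f i)"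
proof -
  have "(\<Sum>i=0..k. y ^ i * f i) = f 0 + (\<Sum>i=1..k. y ^ i * f i)" for y
    by (simp add: sum.atLeast_Suc_atMost)
  moreover have "(\<Sum>i=1..k. 0 ^ i * f i) = 0"
    by (rule sum.neutral) auto
  ultimately show ?thesis by simp
qed

lemma Zs_nth_tendsto:
  assumes "k \<ge> 1"
  shows "(\<lambda>N. Zs N x $ k) \<longlonglongrightarrow> x ^ k * mzv [k + 1]"
  unfolding Zs_nth by (intro tendsto_intros mzv_upto_tendsto) (use assms in auto)

lemma Ds_nth_tendsto: "(\<lambda>N. Ds N x y $ k - Ds N 0 y $ k) \<longlonglongrightarrow> D_real (k + 2) x y"
  unfolding Ds_nth power_sum_minus_at_0 D_real_altdef
  by (intro tendsto_intros mzv_upto_tendsto) auto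

lemma Ts_nth_tendsto: "(\<lambda>N. Ts N x y z $ k - Ts N 0 y z $ k) \<longlonglongrightarrow> T_real (k + 3) x y z"
  unfolding Ts_nth power_sum_minus_at_0 T_real_altdef
  by (intro tendsto_intros mzv_upto_tendsto) auto

section \<open>Double shuffle relations, truncated and in the limit\<close>

lemma double_shuffle_depth3:
  assumes "a \<noteq> c" "b \<noteq> c"
  shows "fps_X * (Ts N (a + c) (b + c) c + Ts N (a + c) (b + c) b + Ts N (a + c) a b + err3 N a b c) =
    fps_X * (Ts N a b c + Ts N a c b + Ts N c a b)
    + fps_const (1 / (a - c)) * (Ds N a b - Ds N c b)
    + fps_const (1 / (b - c)) * (Ds N a b - Ds N a c)"
  unfolding shuffle_depth3[symmetric] stuffle_depth3[OF assms] ..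

text \<open>The factor \<open>fps_X\<close> lines up the weights: coefficient \<open>k\<close> in
  depth 3 and \<open>Suc k\<close> in depth 2 both belong to weight \<open>k + 3\<close>.\<close>

lemma double_shuffle_depth3_nth:
  assumes "a \<noteq> c" "b \<noteq> c"
  shows "Ts N (a + c) (b + c) c $ k + Ts N (a + c) (b + c) b $ k + Ts N (a + c) a b $ k + err3 N a b c $ k =
    Ts N a b c $ k + Ts N a c b $ k + Ts N c a b $ k
    + (Ds N a b $ Suc k - Ds N c b $ Suc k) / (a - c)
    + (Ds N a b $ Suc k - Ds N a c $ Suc k) / (b - c)"
  using arg_cong[OF double_shuffle_depth3[OF assms, of N], of "\<lambda>f. f $ Suc k"] by simp

text \<open>\<open>Zs N a * Zs N b * Zs N c\<close> is expanded by two successive shuffles and by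
  two successive stuffles; the latter cost two factors \<open>fps_X\<close>.\<close>

lemma triple_product_nth:
  assumes "a \<noteq> b" "a \<noteq> c" "b \<noteq> c"
  shows "Ts N (a + b + c) (b + c) c $ k + Ts N (a + b + c) (b + c) b $ k + Ts N (a + b + c) (a + b) b $ k
    + Ts N (a + b + c) (a + c) c $ k + Ts N (a + b + c) (a + c) a $ k + Ts N (a + b + c) (a + b) a $ k
    + err3 N (a + b) b c $ k + err3 N (a + b) a c $ k + (err2 N a b * Zs N c) $ k =
    Ts N a b c $ k + Ts N a c b $ k + Ts N c a b $ k + Ts N b a c $ k + Ts N b c a $ k + Ts N c b a $ k
    + (Ds N a b $ Suc k - Ds N c b $ Suc k) / (a - c)
    + (Ds N a b $ Suc k - Ds N a c $ Suc k) / (b - c)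
    + (Ds N b a $ Suc k - Ds N c a $ Suc k) / (b - c)
    + (Ds N b a $ Suc k - Ds N b c $ Suc k) / (a - c)
    + (Ds N a c $ Suc k + Ds N c a $ Suc k - Ds N b c $ Suc k - Ds N c b $ Suc k) / (a - b)
    + ((Zs N a $ Suc (Suc k) - Zs N c $ Suc (Suc k)) / (a - c)
       - (Zs N b $ Suc (Suc k) - Zs N c $ Suc (Suc k)) / (b - c)) / (a - b)"
proof -
  have X: "(fps_X * f) $ Suc n = f $ n" for f :: "real fps" and n
    by simp
  have sh: "Zs N a * Zs N b * Zs N c =
      Ts N (a + b + c) (b + c) c + Ts N (a + b + c) (b + c) b + Ts N (a + b + c) (a + b) b
      + err3 N (a + b) b c
      + (Ts N (a + b + c) (a + c) c + Ts N (a + b + c) (a + c) a + Ts N (a + b + c) (a + b) a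
      + err3 N (a + b) a c) + err2 N a b * Zs N c"
    unfolding shuffle_depth2[of N a b] shuffle_depth3[symmetric] by (simp only: ring_distribs)
  have "fps_X * (fps_X * (Zs N a * Zs N b * Zs N c)) = fps_X * (fps_X * (Zs N a * Zs N b)) * Zs N c"
    by (simp only: mult_ac)
  also have "\<dots> = fps_X * (fps_X * (Ds N a b * Zs N c)) + fps_X * (fps_X * (Ds N b a * Zs N c))
      + fps_const (1 / (a - b)) * (fps_X * (Zs N a * Zs N c) - fps_X * (Zs N b * Zs N c))"
    unfolding stuffle_depth2[OF assms(1)] by (simp add: algebra_simps)
  finally have "(fps_X * (fps_X * (Zs N a * Zs N b * Zs N c))) $ Suc (Suc k) =
      (fps_X * (fps_X * (Ds N a b * Zs N c)) + fps_X * (fps_X * (Ds N b a * Zs N c))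
      + fps_const (1 / (a - b)) * (fps_X * (Zs N a * Zs N c) - fps_X * (Zs N b * Zs N c))) $ Suc (Suc k)"
    by (rule arg_cong)
  thus ?thesis
    unfolding sh stuffle_depth2[OF assms(2)] stuffle_depth2[OF assms(3)]
      stuffle_depth3[OF assms(2,3)] stuffle_depth3[OF assms(3,2)]
      X fps_mult_left_const_nth fps_add_nth fps_sub_nth times_divide_eq_left mult_1_left
      add_divide_distrib diff_divide_distrib
    by (simp only: algebra_simps)
qed

text \<open>The truncated relation minus its instance with first argument 0. Only the convergent
  differences \<open>t\<close> and \<open>d\<close> remain, and the errors cancel up to a null
  sequence because their approximation in \<open>err3_diff_tendsto_0\<close> does not involve the
  first argument.\<close>

lemma double_shuffle_real_1:
  assumes "a \<noteq> c" "b \<noteq> c" "c \<noteq> 0" and l: "l \<ge> 3"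
  shows "T_real l (a + c) (b + c) c + T_real l (a + c) (b + c) b + T_real l (a + c) a b + D_real l c b / c
     = T_real l a b c + T_real l a c b + T_real l c a b + T_real l c (b + c) c + T_real l c (b + c) b
       + (D_real l a b - D_real l c b) / (a - c) + (D_real l a b - D_real l a c) / (b - c)"
proof -
  define k where "k = l - 3"
  have k: "l = k + 3" using l by (simp add: k_def)
  define t where "t N x y z = Ts N x y z $ k - Ts N 0 y z $ k" for N x y z
  define d where "d N x y = Ds N x y $ Suc k - Ds N 0 y $ Suc k" for N x y
  define e where "e N = err3 N a b c $ k - err3 N 0 b c $ k" for N
  have T: "(\<lambda>N. t N x y z) \<longlonglongrightarrow> T_real l x y z" for x y z
    unfolding t_def k by (rule Ts_nth_tendsto)
  have D: "(\<lambda>N. d N x y) \<longlonglongrightarrow> D_real l x y" for x y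
    using Ds_nth_tendsto[of x y "k + 1"] unfolding d_def k by (simp add: eval_nat_numeral)
  have E: "e \<longlonglongrightarrow> 0"
    using tendsto_diff[OF err3_diff_tendsto_0[of a b c k] err3_diff_tendsto_0[of 0 b c k]]
    by (simp add: e_def[abs_def])
  have eq: "t N (a + c) (b + c) c + t N (a + c) (b + c) b + t N (a + c) a b + d N c b / c + e N
     - (t N a b c + t N a c b + t N c a b + t N c (b + c) c + t N c (b + c) b
       + (d N a b - d N c b) / (a - c) + (d N a b - d N a c) / (b - c)) = 0" for N
    using double_shuffle_depth3_nth[OF assms(1,2), of N k]
      double_shuffle_depth3_nth[of 0 c b N k] assms(2,3)
    unfolding t_def d_def e_def diff_divide_distrib add_0 diff_0 div_minus_right
    by linarith
  have "(\<lambda>N. t N (a + c) (b + c) c + t N (a + c) (b + c) b + t N (a + c) a b + d N c b / c + e N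
     - (t N a b c + t N a c b + t N c a b + t N c (b + c) c + t N c (b + c) b
       + (d N a b - d N c b) / (a - c) + (d N a b - d N a c) / (b - c))) \<longlonglongrightarrow>
     T_real l (a + c) (b + c) c + T_real l (a + c) (b + c) b + T_real l (a + c) a b + D_real l c b / c + 0
     - (T_real l a b c + T_real l a c b + T_real l c a b + T_real l c (b + c) c + T_real l c (b + c) b
       + (D_real l a b - D_real l c b) / (a - c) + (D_real l a b - D_real l a c) / (b - c))"
    by (intro tendsto_add tendsto_diff tendsto_divide tendsto_const T D E) (use assms in auto)
  hence "(\<lambda>N. 0 :: real) \<longlonglongrightarrow> T_real l (a + c) (b + c) c + T_real l (a + c) (b + c) b + T_real l (a + c) a b + D_real l c b / c + 0
     - (T_real l a b c + T_real l a c b + T_real l c a b + T_real l c (b + c) c + T_real l c (b + c) b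
       + (D_real l a b - D_real l c b) / (a - c) + (D_real l a b - D_real l a c) / (b - c))"
    unfolding eq .
  from LIMSEQ_unique[OF this tendsto_const] show ?thesis by simp
qed

text \<open>The truncated triple product is combined with the depth 3 relations for
  \<open>(0, b, c)\<close>, \<open>(0, c, a)\<close> and \<open>(0, a, b)\<close>. These supply the
  cyclic terms and remove the divergent parts.\<close>

lemma double_shuffle_real_2:
  assumes "a \<noteq> b" "a \<noteq> c" "b \<noteq> c" "a \<noteq> 0" "b \<noteq> 0" "c \<noteq> 0" and l: "l \<ge> 4"
  shows "T_real l (a + b + c) (b + c) c + T_real l (a + b + c) (b + c) b + T_real l (a + b + c) (a + b) b
    + T_real l (a + b + c) (a + c) c + T_real l (a + b + c) (a + c) a + T_real l (a + b + c) (a + b) a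
    + D_real l c b / c + D_real l a c / a + D_real l b a / b
    = T_real l a b c + T_real l a c b + T_real l c a b + T_real l b a c + T_real l b c a + T_real l c b a
    + (D_real l a b - D_real l c b) / (a - c)
    + (D_real l a b - D_real l a c) / (b - c)
    + (D_real l b a - D_real l c a) / (b - c)
    + (D_real l b a - D_real l b c) / (a - c)
    + (D_real l a c + D_real l c a - D_real l b c - D_real l c b) / (a - b)
    + T_real l c (b + c) c + T_real l c (b + c) b
    + T_real l a (c + a) a + T_real l a (c + a) c
    + T_real l b (a + b) b + T_real l b (a + b) a
    + ((a ^ (l - 1) * mzv [l] - c ^ (l - 1) * mzv [l]) / (a - c)
       - (b ^ (l - 1) * mzv [l] - c ^ (l - 1) * mzv [l]) / (b - c)) / (a - b)" (is "?L = ?R")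
proof -
  define k where "k = l - 3"
  have k: "l = k + 3" "k \<ge> 1" using l by (simp_all add: k_def)
  define t where "t N x y z = Ts N x y z $ k - Ts N 0 y z $ k" for N x y z
  define d where "d N x y = Ds N x y $ Suc k - Ds N 0 y $ Suc k" for N x y
  define z where "z N x = Zs N x $ Suc (Suc k)" for N x
  define e where "e N = err3 N (a + b) b c $ k + err3 N (a + b) a c $ k + (err2 N a b * Zs N c) $ k
    - err3 N 0 b c $ k - err3 N 0 c a $ k - err3 N 0 a b $ k" for N
  have T: "(\<lambda>N. t N x y z) \<longlonglongrightarrow> T_real l x y z" for x y z
    unfolding t_def k by (rule Ts_nth_tendsto)
  have D: "(\<lambda>N. d N x y) \<longlonglongrightarrow> D_real l x y" for x y
    using Ds_nth_tendsto[of x y "k + 1"] unfolding d_def k by (simp add: eval_nat_numeral)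
  have Z: "(\<lambda>N. z N x) \<longlonglongrightarrow> x ^ (l - 1) * mzv [l]" for x
    using Zs_nth_tendsto[of "k + 2" x] unfolding z_def k by (simp add: eval_nat_numeral)
  \<comment> \<open>Up to null sequences, the multiples of \<open>err2 N 0 0\<close> add up to
    \<open>err2 N 0 0 * Zs N 0\<close>: the differences at \<open>a\<close> and \<open>b\<close>
    cancel, and \<open>Zs N c\<close> meets \<open>- (Zs N c - Zs N 0)\<close>. This and the
    remaining \<open>err3 N 0 0 0\<close> are constant series, with no coefficient at
    \<open>k \<ge> 1\<close>.\<close>
  have E: "e \<longlonglongrightarrow> 0"
  proof -
    let ?r = "\<lambda>x y z N. (err3 N x y z - err3 N 0 0 0 - err2 N 0 0 * (Zs N y - Zs N 0)) $ k"
    have "e = (\<lambda>N. ?r (a + b) b c N + ?r (a + b) a c N + ((err2 N a b - err2 N 0 0) * Zs N c) $ k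
        - ?r 0 b c N - ?r 0 c a N - ?r 0 a b N)"
      using err_at_0_nth[of k] k by (intro ext) (simp add: e_def algebra_simps)
    moreover have "(\<lambda>N. ?r (a + b) b c N + ?r (a + b) a c N + ((err2 N a b - err2 N 0 0) * Zs N c) $ k
        - ?r 0 b c N - ?r 0 c a N - ?r 0 a b N) \<longlonglongrightarrow> 0 + 0 + 0 - 0 - 0 - 0"
      by (intro tendsto_add tendsto_diff err3_diff_tendsto_0 err2_diff_tendsto_0)
    ultimately show ?thesis by simp
  qed
  define L where "L N = t N (a + b + c) (b + c) c + t N (a + b + c) (b + c) b + t N (a + b + c) (a + b) b
    + t N (a + b + c) (a + c) c + t N (a + b + c) (a + c) a + t N (a + b + c) (a + b) a
    + d N c b / c + d N a c / a + d N b a / b" for N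
  define R where "R N = t N a b c + t N a c b + t N c a b + t N b a c + t N b c a + t N c b a
    + (d N a b - d N c b) / (a - c)
    + (d N a b - d N a c) / (b - c)
    + (d N b a - d N c a) / (b - c)
    + (d N b a - d N b c) / (a - c)
    + (d N a c + d N c a - d N b c - d N c b) / (a - b)
    + t N c (b + c) c + t N c (b + c) b
    + t N a (c + a) a + t N a (c + a) c
    + t N b (a + b) b + t N b (a + b) a
    + ((z N a - z N c) / (a - c) - (z N b - z N c) / (b - c)) / (a - b)" for N
  have flip: "x / (c - a) = - (x / (a - c))" for x
    by (metis minus_diff_eq minus_divide_right)
  have eq: "R N - L N = e N" for N
  proof -
    \<comment> \<open>Stuffle side minus shuffle side of the depth 3 relation.\<close>
    define dbl where "dbl x y w = Ts N x w y $ k + Ts N w x y $ k + Ts N x y w $ k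
      + (Ds N x y $ Suc k - Ds N w y $ Suc k) / (x - w) + (Ds N x y $ Suc k - Ds N x w $ Suc k) / (y - w)
      - (Ts N (x + w) (y + w) w $ k + Ts N (x + w) (y + w) y $ k + Ts N (x + w) x y $ k
         + err3 N x y w $ k)" for x y w
    have "dbl 0 b c = 0" "dbl 0 c a = 0" "dbl 0 a b = 0"
      using double_shuffle_depth3_nth[of 0 c b N k] double_shuffle_depth3_nth[of 0 a c N k]
        double_shuffle_depth3_nth[of 0 b a N k] assms(1-6)
      by (simp_all add: dbl_def)
    moreover have "R N - L N - e N = - (dbl 0 b c + dbl 0 c a + dbl 0 a b)"
      using triple_product_nth[OF assms(1-3), of N k]
      unfolding L_def R_def t_def d_def z_def e_def dbl_def diff_divide_distrib add_divide_distrib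
        add_0 diff_0 div_minus_right flip
      by (simp only: algebra_simps)
    ultimately show ?thesis by simp
  qed
  have "L \<longlonglongrightarrow> ?L" unfolding L_def
    by (intro tendsto_add tendsto_diff tendsto_divide tendsto_const T D Z) (use assms in auto)
  moreover have "R \<longlonglongrightarrow> ?R" unfolding R_def
    by (intro tendsto_add tendsto_diff tendsto_divide tendsto_const T D Z) (use assms in auto)
  ultimately have "(\<lambda>N. R N - L N) \<longlonglongrightarrow> ?R - ?L" by (intro tendsto_diff)
  hence "e \<longlonglongrightarrow> ?R - ?L" unfolding eq .
  from LIMSEQ_unique[OF this E] show ?thesis by simp
qed

section \<open>From real arguments to indeterminates\<close>

type_synonym poly3 = "real poly poly poly"

definition eval3 :: "(nat \<Rightarrow> real) \<Rightarrow> poly3 \<Rightarrow> real" where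
  "eval3 X p = poly (poly (poly p [:[:X 3:]:]) [:X 2:]) (X 1)"

lemma eval3_hom [simp]:
  "eval3 X (p + q) = eval3 X p + eval3 X q"
  "eval3 X (p - q) = eval3 X p - eval3 X q"
  "eval3 X (p * q) = eval3 X p * eval3 X q"
  "eval3 X 0 = 0" "eval3 X 1 = 1"
  by (simp_all add: eval3_def)

lemma poly_eq_0_if_infinite_roots:
  fixes p :: "'a :: idom poly"
  assumes "infinite S" "\<And>s. s \<in> S \<Longrightarrow> poly p s = 0"
  shows "p = 0"
  using poly_roots_finite[of p] finite_subset[of S "{x. poly p x = 0}"] assms by blast

text \<open>The variables are removed one at a time, innermost first; the constants are infinitely
  many roots in each coefficient ring.\<close>

lemma eval3_eq_0_imp_eq_0:
  assumes "\<And>X. eval3 X p = 0"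
  shows "p = 0"
proof -
  have "poly (poly (poly p [:[:z:]:]) [:y:]) x = 0" for x y z
    using assms[of "(\<lambda>_. 0)(1 := x, 2 := y, 3 := z)"] by (simp add: eval3_def)
  hence "poly (poly p [:[:z:]:]) [:y:] = 0" for y z
    by (intro poly_eq_0_if_infinite_roots[of UNIV]) (auto simp: infinite_UNIV_char_0)
  moreover have inf1: "infinite (range (\<lambda>y :: real. [:y:]))"
    by (auto dest!: finite_imageD simp: inj_on_def infinite_UNIV_char_0)
  ultimately have "poly p [:[:z:]:] = 0" for z
    by (intro poly_eq_0_if_infinite_roots[OF inf1]) auto
  moreover have "infinite (range (\<lambda>z :: real. [:[:z:]:]))"
    by (auto dest!: finite_imageD simp: inj_on_def infinite_UNIV_char_0)
  ultimately show "p = 0"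
    by (intro poly_eq_0_if_infinite_roots[of "range (\<lambda>z :: real. [:[:z:]:])"]) auto
qed

text \<open>\<open>F\<close> is constrained only where some denominator \<open>q\<close> is nonzero.
  Hence all field operations, even division by 0, respect the relation without side
  conditions.\<close>

definition represents :: "ratfun3 \<Rightarrow> ((nat \<Rightarrow> real) \<Rightarrow> real) \<Rightarrow> bool" where
  "represents f F \<longleftrightarrow> (\<exists>p q. q \<noteq> 0 \<and> f = to_fract p / to_fract q \<and>
     (\<forall>X. eval3 X q \<noteq> 0 \<longrightarrow> F X = eval3 X p / eval3 X q))"

lemma representsI:
  assumes "q \<noteq> 0" "f = to_fract p / to_fract q"
    "\<And>X. eval3 X q \<noteq> 0 \<Longrightarrow> F X = eval3 X p / eval3 X q"
  shows "represents f F"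
  using assms unfolding represents_def by blast

lemma represents_to_fract: "represents (to_fract p) (\<lambda>X. eval3 X p)"
  by (rule representsI[of 1 _ p]) simp_all

lemma represents_1: "represents 1 (\<lambda>X. 1)"
  using represents_to_fract[of 1] by simp

lemma represents_0: "represents 0 (\<lambda>X. 0)"
  using represents_to_fract[of 0] by simp

lemma represents_rconst: "represents (rconst c) (\<lambda>X. c)"
  using represents_to_fract[of "[:[:[:c:]:]:]"] by (simp add: rconst_def eval3_def)

lemma represents_indet:
  assumes "i \<in> {1, 2, 3}"
  shows "represents (\<xi> i) (\<lambda>X. X i)"
  using assms represents_to_fract[of "[:[:[:0, 1:]:]:]"] represents_to_fract[of "[:[:0, 1:]:]"]
    represents_to_fract[of "[:0, 1:]"]
  by (auto simp: indet_def eval3_def)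

lemma represents_add:
  assumes "represents f F" "represents g G"
  shows "represents (f + g) (\<lambda>X. F X + G X)"
proof -
  from assms obtain p q p' q' where
    "q \<noteq> 0" "f = to_fract p / to_fract q" "\<And>X. eval3 X q \<noteq> 0 \<Longrightarrow> F X = eval3 X p / eval3 X q"
    "q' \<noteq> 0" "g = to_fract p' / to_fract q'" "\<And>X. eval3 X q' \<noteq> 0 \<Longrightarrow> G X = eval3 X p' / eval3 X q'"
    unfolding represents_def by blast
  thus ?thesis by (intro representsI[of "q * q'" _ "p * q' + p' * q"]) (auto simp: add_frac_eq)
qed

lemma represents_mult:
  assumes "represents f F" "represents g G"
  shows "represents (f * g) (\<lambda>X. F X * G X)"
proof -
  from assms obtain p q p' q' where
    "q \<noteq> 0" "f = to_fract p / to_fract q" "\<And>X. eval3 X q \<noteq> 0 \<Longrightarrow> F X = eval3 X p / eval3 X q"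
    "q' \<noteq> 0" "g = to_fract p' / to_fract q'" "\<And>X. eval3 X q' \<noteq> 0 \<Longrightarrow> G X = eval3 X p' / eval3 X q'"
    unfolding represents_def by blast
  thus ?thesis by (intro representsI[of "q * q'" _ "p * p'"]) auto
qed

lemma represents_diff:
  assumes "represents f F" "represents g G"
  shows "represents (f - g) (\<lambda>X. F X - G X)"
proof -
  from assms obtain p q p' q' where
    "q \<noteq> 0" "f = to_fract p / to_fract q" "\<And>X. eval3 X q \<noteq> 0 \<Longrightarrow> F X = eval3 X p / eval3 X q"
    "q' \<noteq> 0" "g = to_fract p' / to_fract q'" "\<And>X. eval3 X q' \<noteq> 0 \<Longrightarrow> G X = eval3 X p' / eval3 X q'"
    unfolding represents_def by blast
  thus ?thesis by (intro representsI[of "q * q'" _ "p * q' - p' * q"]) (auto simp: diff_frac_eq)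
qed

lemma represents_divide:
  assumes "represents f F" "represents g G"
  shows "represents (f / g) (\<lambda>X. F X / G X)"
proof -
  from assms obtain p q p' q' where pq:
    "q \<noteq> 0" "f = to_fract p / to_fract q" "\<And>X. eval3 X q \<noteq> 0 \<Longrightarrow> F X = eval3 X p / eval3 X q"
    "q' \<noteq> 0" "g = to_fract p' / to_fract q'" "\<And>X. eval3 X q' \<noteq> 0 \<Longrightarrow> G X = eval3 X p' / eval3 X q'"
    unfolding represents_def by blast
  show ?thesis
  proof (cases "p' = 0")
    \<comment> \<open>Here \<open>g = 0\<close>, and \<open>f / g\<close> and
      \<open>F X / G X\<close> both take the default value 0.\<close>
    case True
    with pq show ?thesis by (intro representsI[of q' _ 0]) auto
  next
    case False
    with pq show ?thesis
      \<comment> \<open>The additional factor \<open>q'\<close> restricts to points where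
        \<open>G X\<close> is known.\<close>
      by (intro representsI[of "q * p' * q'" _ "p * q' * q'"]) auto
  qed
qed

lemma represents_power: "represents f F \<Longrightarrow> represents (f ^ n) (\<lambda>X. F X ^ n)"
  by (induction n) (simp_all add: represents_1 represents_mult)

lemma represents_sum:
  assumes "\<And>i. i \<in> A \<Longrightarrow> represents (f i) (F i)"
  shows "represents (\<Sum>i\<in>A. f i) (\<lambda>X. \<Sum>i\<in>A. F i X)"
  using assms
  by (induction A rule: infinite_finite_induct) (simp_all add: represents_0 represents_add)

lemma represents_unique:
  assumes "represents f F" "represents g G" "d \<noteq> 0"
    "\<And>X. eval3 X d \<noteq> 0 \<Longrightarrow> F X = G X"
  shows "f = g"
proof -
  from assms(1,2) obtain p q p' q' where pq:
    "q \<noteq> 0" "f = to_fract p / to_fract q" "\<And>X. eval3 X q \<noteq> 0 \<Longrightarrow> F X = eval3 X p / eval3 X q"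
    "q' \<noteq> 0" "g = to_fract p' / to_fract q'" "\<And>X. eval3 X q' \<noteq> 0 \<Longrightarrow> G X = eval3 X p' / eval3 X q'"
    unfolding represents_def by blast
  \<comment> \<open>The factor \<open>d * q * q'\<close> makes the polynomial vanish also at points
    where nothing is known about \<open>F\<close> and \<open>G\<close>.\<close>
  have "eval3 X (d * q * q' * (p * q' - p' * q)) = 0" for X
  proof (cases "eval3 X (d * q * q') = 0")
    case False
    hence "eval3 X p / eval3 X q = eval3 X p' / eval3 X q'"
      using pq(3)[of X] pq(6)[of X] assms(4)[of X] by auto
    thus ?thesis using False by (simp add: frac_eq_eq)
  qed simp
  hence "d * q * q' * (p * q' - p' * q) = 0" by (rule eval3_eq_0_imp_eq_0)
  hence "p * q' = p' * q" using pq assms(3) by simp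
  hence "to_fract p * to_fract q' = to_fract p' * to_fract q"
    by (simp flip: to_fract_mult)
  thus ?thesis using pq by (simp add: frac_eq_eq)
qed

lemma represents_unique_generic:
  assumes "represents f F" "represents g G"
    "\<And>X. \<lbrakk>X 1 \<noteq> 0; X 2 \<noteq> 0; X 3 \<noteq> 0; X 1 \<noteq> X 2; X 1 \<noteq> X 3; X 2 \<noteq> X 3\<rbrakk> \<Longrightarrow> F X = G X"
  shows "f = g"
proof (rule represents_unique[OF assms(1,2)])
  define x y z :: poly3 where xyz: "x = [:[:[:0, 1:]:]:]" "y = [:[:0, 1:]:]" "z = [:0, 1:]"
  show "x * y * z * (x - y) * (x - z) * (y - z) \<noteq> 0"
    by (simp add: xyz)
  fix X assume "eval3 X (x * y * z * (x - y) * (x - z) * (y - z)) \<noteq> 0"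
  moreover have "eval3 X x = X 1" "eval3 X y = X 2" "eval3 X z = X 3"
    by (simp_all add: xyz eval3_def)
  ultimately show "F X = G X"
    by (intro assms(3)) auto
qed

lemma represents_D_gen:
  assumes "represents x F" "represents y G"
  shows "represents (D_gen l x y) (\<lambda>X. D_real l (F X) (G X))"
  unfolding D_gen_def D_real_def
  by (intro represents_sum)
     (auto intro!: represents_mult represents_power represents_rconst assms)

lemma represents_T_gen:
  assumes "represents x F" "represents y G" "represents z H"
  shows "represents (T_gen l x y z) (\<lambda>X. T_real l (F X) (G X) (H X))"
  unfolding T_gen_def T_real_def
  by (intro represents_sum)
     (auto intro!: represents_mult represents_power represents_rconst assms)

lemma represents_indets:
  "represents (\<xi> 1) (\<lambda>X. X 1)" "represents (\<xi> 2) (\<lambda>X. X 2)" "represents (\<xi> 3) (\<lambda>X. X 3)"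
  by (simp_all only: represents_indet insert_iff simp_thms)

lemmas represents_intros = represents_add represents_diff represents_mult represents_divide
  represents_power represents_rconst represents_D_gen represents_T_gen represents_indets

section \<open>Permutation and cyclic sums, and the identities for indeterminates\<close>

lemma sum_permutes_3:
  fixes f :: "nat \<Rightarrow> nat \<Rightarrow> nat \<Rightarrow> 'a :: comm_monoid_add"
  shows "(\<Sum>\<sigma> | \<sigma> permutes {1, 2, 3}. f (\<sigma> 1) (\<sigma> 2) (\<sigma> 3)) =
    f 1 2 3 + f 1 3 2 + f 2 1 3 + f 2 3 1 + f 3 1 2 + f 3 2 1"
proof -
  have 1: "finite {2, 3 :: nat}" "1 \<notin> {2, 3 :: nat}" and 2: "finite {3 :: nat}" "2 \<notin> {3 :: nat}"
    by auto
  show ?thesis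
    unfolding sum_over_permutations_insert[OF 1] sum_over_permutations_insert[OF 2] permutes_sing
    by (simp add: transpose_def add_ac)
qed

lemma sum_cyc3: "(\<Sum>(i, j, k) \<in> cyc3. f i j k) = f 1 2 3 + f 2 3 1 + f 3 1 2"
  by (simp add: cyc3_def add_ac)

text \<open>A second divided difference, as two stuffles produce it, is brought into the symmetric
  form in which the \<open>zeta(l)\<close> terms are stated.\<close>

lemma divided_difference_3:
  fixes a b c :: real
  assumes "a \<noteq> b" "a \<noteq> c" "b \<noteq> c"
  shows "((A * z - C * z) / (a - c) - (B * z - C * z) / (b - c)) / (a - b) =
     A / ((a - b) * (a - c)) * z + B / ((b - c) * (b - a)) * z + C / ((c - a) * (c - b)) * z"
proof -
  have "((A * z - C * z) / u - (B * z - C * z) / v) / (u - v) =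
      A / ((u - v) * u) * z + B / (v * - (u - v)) * z + C / (- u * - v) * z"
    if "u \<noteq> 0" "v \<noteq> 0" "u - v \<noteq> 0" for u v
    using that by (simp add: divide_simps) (simp add: algebra_simps)
  from this[of "a - c" "b - c"] assms show ?thesis by simp
qed

lemma divide_diff_flip: "x / (d - c) = - (x / (c - d))" for x c d :: real
  by (metis minus_diff_eq minus_divide_right)

lemma double_shuffle_ratfun_1:
  assumes "l \<ge> 3"
  shows "T_gen l (\<xi> 1 + \<xi> 3) (\<xi> 2 + \<xi> 3) (\<xi> 3) + T_gen l (\<xi> 1 + \<xi> 3) (\<xi> 3 + \<xi> 2) (\<xi> 2)
     + T_gen l (\<xi> 3 + \<xi> 1) (\<xi> 1) (\<xi> 2) + D_gen l (\<xi> 3) (\<xi> 2) / \<xi> 3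
   = T_gen l (\<xi> 1) (\<xi> 2) (\<xi> 3) + T_gen l (\<xi> 1) (\<xi> 3) (\<xi> 2) + T_gen l (\<xi> 3) (\<xi> 1) (\<xi> 2)
     + T_gen l (\<xi> 3) (\<xi> 2 + \<xi> 3) (\<xi> 3) + T_gen l (\<xi> 3) (\<xi> 3 + \<xi> 2) (\<xi> 2)
     + D_gen l (\<xi> 1) (\<xi> 2) / (\<xi> 1 - \<xi> 3) + D_gen l (\<xi> 3) (\<xi> 2) / (\<xi> 3 - \<xi> 1)
     + D_gen l (\<xi> 1) (\<xi> 2) / (\<xi> 2 - \<xi> 3) + D_gen l (\<xi> 1) (\<xi> 3) / (\<xi> 3 - \<xi> 2)"
\<comment> \<open>The introduction rules build the functions represented by both sides; what remains
  is the identity at nonzero, pairwise distinct reals.\<close>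
proof (rule represents_unique_generic, (rule represents_intros)+, goal_cases)
  case (1 X)
  define a b c where abc: "a = X 1" "b = X 2" "c = X 3"
  from 1 have "a \<noteq> c" "b \<noteq> c" "c \<noteq> 0" by (simp_all add: abc)
  from double_shuffle_real_1[OF this assms]
  show ?case
    unfolding abc[symmetric] diff_divide_distrib divide_diff_flip[of _ c a] divide_diff_flip[of _ c b]
    by (simp add: add_ac)
qed

lemma double_shuffle_ratfun_2:
  assumes "l \<ge> 4"
  shows "(\<Sum>\<sigma> | \<sigma> permutes {1, 2, 3}.
       T_gen l (\<xi> 1 + \<xi> 2 + \<xi> 3) (\<xi> (\<sigma> 2) + \<xi> (\<sigma> 3)) (\<xi> (\<sigma> 3)))
     + (\<Sum>(i, j, k) \<in> cyc3. D_gen l (\<xi> k) (\<xi> j) / \<xi> k)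
   = (\<Sum>\<sigma> | \<sigma> permutes {1, 2, 3}.
       T_gen l (\<xi> (\<sigma> 1)) (\<xi> (\<sigma> 2)) (\<xi> (\<sigma> 3))
       + D_gen l (\<xi> (\<sigma> 1)) (\<xi> (\<sigma> 2)) / (\<xi> (\<sigma> 1) - \<xi> (\<sigma> 3))
       + D_gen l (\<xi> (\<sigma> 1)) (\<xi> (\<sigma> 2)) / (\<xi> (\<sigma> 2) - \<xi> (\<sigma> 3)))
     + (\<Sum>(i, j, k) \<in> cyc3.
       T_gen l (\<xi> k) (\<xi> j + \<xi> k) (\<xi> k) + T_gen l (\<xi> k) (\<xi> k + \<xi> j) (\<xi> j)
       + \<xi> i ^ (l - 1) / ((\<xi> i - \<xi> j) * (\<xi> i - \<xi> k)) * rconst (mzv [l]))"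
  unfolding sum_permutes_3[of "\<lambda>i j k. T_gen l (\<xi> 1 + \<xi> 2 + \<xi> 3) (\<xi> j + \<xi> k) (\<xi> k)"]
    sum_permutes_3[of "\<lambda>i j k. T_gen l (\<xi> i) (\<xi> j) (\<xi> k) + D_gen l (\<xi> i) (\<xi> j) / (\<xi> i - \<xi> k)
      + D_gen l (\<xi> i) (\<xi> j) / (\<xi> j - \<xi> k)"] sum_cyc3
proof (rule represents_unique_generic, (rule represents_intros)+, goal_cases)
  case (1 X)
  define a b c where abc: "a = X 1" "b = X 2" "c = X 3"
  \<comment> \<open>Folding these terms into \<open>w\<close> keeps \<open>algebra_simps\<close>
    from expanding their denominators.\<close>
  define w where "w x y z = x ^ (l - 1) / ((x - y) * (x - z)) * mzv [l]" for x y z :: real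
  from 1 have ne: "a \<noteq> b" "a \<noteq> c" "b \<noteq> c" "a \<noteq> 0" "b \<noteq> 0" "c \<noteq> 0"
    by (simp_all add: abc)
  show ?case
    using double_shuffle_real_2[OF ne assms, unfolded divided_difference_3[OF ne(1-3)]]
    unfolding abc[symmetric] w_def[symmetric] diff_divide_distrib add_divide_distrib
      divide_diff_flip[of _ c a] divide_diff_flip[of _ c b] divide_diff_flip[of _ b a]
    by (simp only: algebra_simps)
qed

theorem theorem1:
  fixes l :: nat
  assumes "l \<ge> 4"
  shows
    "(T_gen l (\<xi> 1 + \<xi> 3) (\<xi> 2 + \<xi> 3) (\<xi> 3) + T_gen l (\<xi> 1 + \<xi> 3) (\<xi> 3 + \<xi> 2) (\<xi> 2)
       + T_gen l (\<xi> 3 + \<xi> 1) (\<xi> 1) (\<xi> 2) + D_gen l (\<xi> 3) (\<xi> 2) / \<xi> 3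
     = T_gen l (\<xi> 1) (\<xi> 2) (\<xi> 3) + T_gen l (\<xi> 1) (\<xi> 3) (\<xi> 2) + T_gen l (\<xi> 3) (\<xi> 1) (\<xi> 2)
       + T_gen l (\<xi> 3) (\<xi> 2 + \<xi> 3) (\<xi> 3) + T_gen l (\<xi> 3) (\<xi> 3 + \<xi> 2) (\<xi> 2)
       + D_gen l (\<xi> 1) (\<xi> 2) / (\<xi> 1 - \<xi> 3) + D_gen l (\<xi> 3) (\<xi> 2) / (\<xi> 3 - \<xi> 1)
       + D_gen l (\<xi> 1) (\<xi> 2) / (\<xi> 2 - \<xi> 3) + D_gen l (\<xi> 1) (\<xi> 3) / (\<xi> 3 - \<xi> 2))
    \<and>
    ((\<Sum>\<sigma> | \<sigma> permutes {1, 2, 3}.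
         T_gen l (\<xi> 1 + \<xi> 2 + \<xi> 3) (\<xi> (\<sigma> 2) + \<xi> (\<sigma> 3)) (\<xi> (\<sigma> 3)))
       + (\<Sum>(i, j, k) \<in> cyc3. D_gen l (\<xi> k) (\<xi> j) / \<xi> k)
     = (\<Sum>\<sigma> | \<sigma> permutes {1, 2, 3}.
         T_gen l (\<xi> (\<sigma> 1)) (\<xi> (\<sigma> 2)) (\<xi> (\<sigma> 3))
         + D_gen l (\<xi> (\<sigma> 1)) (\<xi> (\<sigma> 2)) / (\<xi> (\<sigma> 1) - \<xi> (\<sigma> 3))
         + D_gen l (\<xi> (\<sigma> 1)) (\<xi> (\<sigma> 2)) / (\<xi> (\<sigma> 2) - \<xi> (\<sigma> 3)))
       + (\<Sum>(i, j, k) \<in> cyc3.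
         T_gen l (\<xi> k) (\<xi> j + \<xi> k) (\<xi> k) + T_gen l (\<xi> k) (\<xi> k + \<xi> j) (\<xi> j)
         + \<xi> i ^ (l - 1) / ((\<xi> i - \<xi> j) * (\<xi> i - \<xi> k)) * rconst (mzv [l])))"
  by (rule conjI[OF double_shuffle_ratfun_1 double_shuffle_ratfun_2[OF assms]]) (use assms in simp)

end
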